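(* Let $a,b>0$ and let $n\ge 1$ be an integer. Define the plane curves $$C_{2n}=\Big\{\big(-\cot\tfrac{\theta}{2}\cot(n\theta),\ \cot((n+\tfrac12)\theta)\cot(n\theta)\big):\ \tfrac{(2n-1)\pi}{2n}<\theta<\tfrac{2n\pi}{2n+1}\Big\},$$ $$C_{2n+1}=\Big\{\big(\cot\tfrac{\theta}{2}\cot((n+1)\theta),\ \cot((n+\tfrac12)\theta)\cot((n+1)\theta)\big):\ \tfrac{2n\pi}{2n+1}<\theta<\tfrac{(2n+1)\pi}{2n+2}\Big\}.$$ Then the collision sequence $(2)(32)^n$ is allowed as a capture process for mass ratios $(a,b)$ if and only if $(a,b)$ lies between the curves $C_{2n}$ (below) and $C_{2n+1}$ (above), boundaries included; that is, if and only if there is $b'\le b$ with $(a,b')\in C_{2n}$, and $b\le b''$ for every $b''$ with $(a,b'')\in C_{2n+1}$.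
   Context: Setting: three point particles 1, 2, 3 move in the plane, identified with $\mathbb{C}$, with masses $m_1,m_2,m_3>0$; put $a=m_1/m_2$, $b=m_3/m_2$. Between collisions particles move freely with constant velocity. A collision "$(i)$", $i\in\{1,2,3\}$, is a collision between the two particles other than $i$ (the spectator): the two particles are at the same position with nonzero relative velocity, and instantaneously their velocities change so that their total momentum is conserved and their relative velocity is multiplied by a complex number $x=e^{i\alpha}$, $|x|=1$ (so kinetic energy is conserved); the spectator's velocity is unchanged. The number $x$ (the scattering angle $\alpha$) may be any unit complex number and may be chosen independently at each collision. A collision sequence is written as a string in order of occurrence from left to right; $(32)^n$ is $(3)(2)(3)(2)\cdots(3)(2)$ with $2n$ collisions and $(2)(32)^n$ is (2) followed by $(32)^n$. The times between successive collisions are required to be strictly positive, and no other interactions occur. Capture process: initially particles 2 and 3 are at rest at distinct points, and particle 1 has a nonzero velocity. A collision sequence is allowed as a capture process for $(a,b)$ if there exist initial positions and velocity of particle 1, initial positions of 2 and 3, and scattering angles such that the collisions of the sequence occur in that order, and after the last collision particles 1 and 2 have equal velocities. Each curve $C_m$ is the graph of $b$ as a function of $a$ over a bounded interval $0<a<A_m$. *)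

theory Defs
  imports Complex_Main
begin

datatype particle = P1 | P2 | P3

text \<open>
  A collision is labelled by its spectator \<open>i\<close>, so the colliding particles are the two others.
  \<open>q\<close> gives the positions, \<open>v\<close> and \<open>v'\<close> the velocities just before and just after the collision.
  The value \<open>x = 1\<close> (forward scattering) is admitted.
\<close>
definition collision ::
  "(particle \<Rightarrow> real) \<Rightarrow> particle \<Rightarrow> (particle \<Rightarrow> complex) \<Rightarrow> (particle \<Rightarrow> complex) \<Rightarrow>
   (particle \<Rightarrow> complex) \<Rightarrow> bool"
where
  "collision m i q v v' \<longleftrightarrow>
     v' i = v i \<and>
     (\<exists>x. cmod x = 1 \<and>
       (\<forall>j k. i \<noteq> j \<and> i \<noteq> k \<and> j \<noteq> k \<longrightarrow>
          q j = q k \<and> v j \<noteq> v k \<and>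
          of_real (m j) * v' j + of_real (m k) * v' k =
            of_real (m j) * v j + of_real (m k) * v k \<and>
          v' j - v' k = x * (v j - v k)))"

text \<open>
  \<open>motion m q v cs q' v'\<close>: from positions \<open>q\<close> and velocities \<open>v\<close>, the collisions \<open>cs\<close> occur in
  this order, each preceded by a free flight of positive duration; \<open>q'\<close> and \<open>v'\<close> are the positions
  and velocities immediately after the last collision.  All velocities are constant between the
  listed collisions: two particles may pass through the same point without interacting.
\<close>
inductive motion ::
  "(particle \<Rightarrow> real) \<Rightarrow> (particle \<Rightarrow> complex) \<Rightarrow> (particle \<Rightarrow> complex) \<Rightarrow> particle list \<Rightarrow>
   (particle \<Rightarrow> complex) \<Rightarrow> (particle \<Rightarrow> complex) \<Rightarrow> bool"
  for m :: "particle \<Rightarrow> real"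
where
  motion_Nil: "motion m q v [] q v"
| motion_Cons:
    "t > 0 \<Longrightarrow> collision m c (\<lambda>i. q i + of_real t * v i) v v\<^sub>1 \<Longrightarrow>
     motion m (\<lambda>i. q i + of_real t * v i) v\<^sub>1 cs q' v' \<Longrightarrow> motion m q v (c # cs) q' v'"

definition capture_process :: "(particle \<Rightarrow> real) \<Rightarrow> particle list \<Rightarrow> bool" where
  "capture_process m cs \<longleftrightarrow>
     (\<exists>q v q' v'. q P2 \<noteq> q P3 \<and> v P2 = 0 \<and> v P3 = 0 \<and> v P1 \<noteq> 0 \<and>
        motion m q v cs q' v' \<and> v' P1 = v' P2)"

definition capture_sequence :: "nat \<Rightarrow> particle list" where
  "capture_sequence n = P2 # concat (replicate n [P3, P2])"

text \<open>
  \<open>C_even n\<close> and \<open>C_odd n\<close> are the curves of index \<open>2 * n\<close> and \<open>2 * n + 1\<close>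
  in the plane of the mass ratios \<open>(m\<^sub>1 / m\<^sub>2, m\<^sub>3 / m\<^sub>2)\<close>.
\<close>

definition C_even :: "nat \<Rightarrow> (real \<times> real) set" where
  "C_even n =
     {(- cot (\<theta> / 2) * cot (real n * \<theta>), cot ((real n + 1/2) * \<theta>) * cot (real n * \<theta>)) | \<theta>.
        (2 * real n - 1) * pi / (2 * real n) < \<theta> \<and> \<theta> < 2 * real n * pi / (2 * real n + 1)}"

definition C_odd :: "nat \<Rightarrow> (real \<times> real) set" where
  "C_odd n =
     {(cot (\<theta> / 2) * cot ((real n + 1) * \<theta>),
       cot ((real n + 1/2) * \<theta>) * cot ((real n + 1) * \<theta>)) | \<theta>.
        2 * real n * pi / (2 * real n + 1) < \<theta> \<and>
        \<theta> < (2 * real n + 1) * pi / (2 * real n + 2)}"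

end

theory Submission
  imports Defs
begin

text \<open>
  Let \<open>D\<close> be the vector between particles 2 and 3 at a collision. During the flight between two
  successive collisions the velocities of particle 1 relative to the two others are the two adjacent
  vectors \<open>D\<close> divided by the flight time, up to sign. Conservation of momentum and of the relative speed then
  says that each \<open>D\<close> bisects the angle between its neighbours, so \<open>D\<close> turns by a constant angle,
  with cosine \<open>c\<close>, and the reciprocal distances satisfy a linear three-term recurrence.
  Capture at the end makes this sequence vanish one step after the last collision, so it is
  \<open>sin (j t)\<close> up to a factor depending on the parity of \<open>j\<close>, where
  \<open>cos t = c cos \<phi>\<close> and \<open>\<phi>\<close> depends only on the masses. The first collision
  turns into \<open>sin ((2 n + 1) t) = K sin t\<close>, which by monotonicity is solvable with
  \<open>\<phi> \<le> t < \<pi> / (2 n + 1)\<close> iff \<open>\<psi> \<le> (2 n + 1) \<phi> \<le> \<pi> - \<psi>\<close>, where \<open>\<phi>\<close>, \<open>\<psi>\<close>, \<open>\<chi>\<close>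
  are the angles of an acute triangle with \<open>a = tan \<phi> / tan \<chi>\<close>, \<open>b = tan \<psi> / tan \<chi>\<close>.
  Equality on either side describes the two curves, with \<open>\<theta> = \<pi> - 2 \<phi>\<close>.
\<close>

section \<open>Dynamics\<close>

text \<open>
  Collisions are numbered backwards: in the one followed by \<open>j\<close> more collisions, particle 1 meets
  \<open>other (Suc j)\<close> and the spectator is \<open>other j\<close>.
\<close>
definition other :: "nat \<Rightarrow> particle" where
  "other j = (if even j then P2 else P3)"

fun alternating :: "nat \<Rightarrow> particle list" where
  "alternating 0 = []"
| "alternating (Suc j) = other j # alternating j"

lemma capture_sequence_eq: "capture_sequence n = other (2 * n) # alternating (2 * n)"
proof -
  have "concat (replicate n [P3, P2]) = alternating (2 * n)"
    by (induction n) (simp_all add: other_def)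
  then show ?thesis
    by (simp add: capture_sequence_def other_def)
qed

lemma other_simps [simp]:
  "other j \<noteq> P1" "P1 \<noteq> other j" "other (Suc j) \<noteq> other j" "other j \<noteq> other (Suc j)"
  "other (Suc (Suc j)) = other j"
  by (auto simp: other_def)

section \<open>Elastic collisions in velocities relative to particle 1\<close>

definition mass_frac :: "(particle \<Rightarrow> real) \<Rightarrow> particle \<Rightarrow> real" where
  "mass_frac m i = m i / (m P1 + m i)"

lemma particle_cases3:
  assumes "i \<noteq> P1" "p \<noteq> P1" "p \<noteq> i"
  shows "k = P1 \<or> k = i \<or> k = p"
  using assms by (cases i; cases p; cases k) auto

text \<open>The velocity of the centre of mass is conserved and the relative velocity is prescribed,
  so the outgoing velocities are determined. The factor \<open>N / (M + N)\<close> becomes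
  \<open>mass_frac\<close> when \<open>V\<close> belongs to particle 1.\<close>

lemma momentum_iff:
  fixes V U V' U' x :: complex
  assumes "M > 0" "N > 0" and rel: "V' - U' = x * (V - U)"
  shows "of_real M * V' + of_real N * U' = of_real M * V + of_real N * U \<longleftrightarrow>
    V' = V - of_real (N / (M + N)) * (1 - x) * (V - U)"
proof -
  have ne: "complex_of_real M + of_real N \<noteq> 0"
    using assms(1,2) by (metis add_pos_pos less_irrefl of_real_add of_real_eq_0_iff)
  have U': "U' = V' - x * (V - U)"
    using rel by (simp add: algebra_simps)
  have "of_real M * V' + of_real N * U' = of_real M * V + of_real N * U \<longleftrightarrow>
    (of_real M + of_real N) * V' = (of_real M + of_real N) * V - of_real N * (1 - x) * (V - U)"
    unfolding U' by (auto simp: algebra_simps)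
  also have "\<dots> \<longleftrightarrow> V' = V - of_real (N / (M + N)) * (1 - x) * (V - U)"
    using ne by (auto simp: field_simps)
  finally show ?thesis .
qed

text \<open>The definition of \<open>collision\<close> ranges over both orders of the colliding
  pair. Exchanging the two particles changes the sign of both relative velocities and keeps the
  factor \<open>x\<close>, so the order with particle 1 first suffices.\<close>

lemma collision_iff:
  assumes pos: "\<And>i. m i > 0" and ne: "i \<noteq> P1" "p \<noteq> P1" "p \<noteq> i"
  shows "collision m i q v v' \<longleftrightarrow>
    v' i = v i \<and> q P1 = q p \<and> v P1 \<noteq> v p \<and>
    (\<exists>x. cmod x = 1 \<and> v' P1 - v' p = x * (v P1 - v p) \<and>
      v' P1 = v P1 - of_real (mass_frac m p) * (1 - x) * (v P1 - v p))"
    (is "?L \<longleftrightarrow> ?R")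
proof -
  define Q where "Q x j k \<longleftrightarrow> q j = q k \<and> v j \<noteq> v k \<and>
          of_real (m j) * v' j + of_real (m k) * v' k =
            of_real (m j) * v j + of_real (m k) * v k \<and>
          v' j - v' k = x * (v j - v k)" for x j k
  have sym: "Q x p P1" if "Q x P1 p" for x
    using that by (auto simp: Q_def algebra_simps)
  have all: "(\<forall>j k. i \<noteq> j \<and> i \<noteq> k \<and> j \<noteq> k \<longrightarrow> Q x j k) \<longleftrightarrow> Q x P1 p" for x
    using ne sym[of x] particle_cases3[OF ne] by metis
  have "?L \<longleftrightarrow> v' i = v i \<and> (\<exists>x. cmod x = 1 \<and> Q x P1 p)"
    unfolding collision_def all[symmetric] by (simp add: Q_def)
  also have "\<dots> \<longleftrightarrow> ?R"
    unfolding Q_def mass_frac_def using momentum_iff[OF pos pos, of "v' P1" "v' p" _ "v P1" "v p" P1 p]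
    by meson
  finally show ?thesis .
qed

section \<open>Capture as a recursion along the collision sequence\<close>

lemma motion_Cons_iff:
  "motion m q v (c # cs) q' v' \<longleftrightarrow>
    (\<exists>t v\<^sub>1. t > 0 \<and> collision m c (\<lambda>i. q i + of_real t * v i) v v\<^sub>1 \<and>
      motion m (\<lambda>i. q i + of_real t * v i) v\<^sub>1 cs q' v')"
  by (subst motion.simps) auto

lemma motion_Nil_iff: "motion m q v [] q' v' \<longleftrightarrow> q' = q \<and> v' = v"
  by (subst motion.simps) auto

definition captures ::
  "(particle \<Rightarrow> real) \<Rightarrow> particle list \<Rightarrow> (particle \<Rightarrow> complex) \<Rightarrow> (particle \<Rightarrow> complex) \<Rightarrow> bool"
where
  "captures m cs q v \<longleftrightarrow> (\<exists>q' v'. motion m q v cs q' v' \<and> v' P1 = v' P2)"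

lemma captures_Nil: "captures m [] q v \<longleftrightarrow> v P1 = v P2"
  by (simp add: captures_def motion_Nil_iff)

text \<open>The later argument uses only velocities of particle 1 relative to the two others.
  Relative to the partner \<open>p\<close> the velocity is multiplied by \<open>x\<close>; relative
  to the spectator \<open>i\<close> it changes exactly as the velocity of particle 1 does, because
  the spectator is not deflected.\<close>

lemma captures_Cons:
  assumes pos: "\<And>i. m i > 0" and ne: "i \<noteq> P1" "p \<noteq> P1" "p \<noteq> i"
  shows "captures m (i # cs) q v \<longleftrightarrow>
    (\<exists>t x v'. t > 0 \<and> cmod x = 1 \<and> v P1 \<noteq> v p \<and> of_real t * (v P1 - v p) = q p - q P1 \<and>
      v' i = v i \<and> v' P1 - v' p = x * (v P1 - v p) \<and>
      v' P1 - v' i = (v P1 - v i) - of_real (mass_frac m p) * (1 - x) * (v P1 - v p) \<and>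
      captures m cs (\<lambda>k. q k + of_real t * v k) v')"
proof -
  have meet: "q P1 + of_real t * v P1 = q p + of_real t * v p \<longleftrightarrow>
      of_real t * (v P1 - v p) = q p - q P1" for t :: real
    by (auto simp: algebra_simps)
  have rel: "v' P1 - v' i = (v P1 - v i) - w \<longleftrightarrow> v' P1 = v P1 - w" if "v' i = v i" for v' w
    using that by (auto simp: algebra_simps)
  show ?thesis
    unfolding captures_def motion_Cons_iff collision_iff[OF pos ne] meet
    using rel by blast
qed

section \<open>Angles between complex vectors and reflections\<close>

definition cosang :: "complex \<Rightarrow> complex \<Rightarrow> real" where
  "cosang w z = Re (w * cnj z) / (cmod w * cmod z)"

lemma cosang_scale: "s > 0 \<Longrightarrow> cosang w (of_real s * z) = cosang w z"
proof -
  assume s: "s > 0"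
  have "Re (w * cnj (of_real s * z)) = s * Re (w * cnj z)"
    by (simp add: algebra_simps)
  then show ?thesis
    using s by (simp add: cosang_def norm_mult del: times_complex.sel)
qed

lemma abs_cosang_le_1: "\<bar>cosang w z\<bar> \<le> 1"
proof -
  have "\<bar>Re (w * cnj z)\<bar> \<le> cmod w * cmod z"
    by (metis abs_Re_le_cmod complex_mod_cnj norm_mult)
  then show ?thesis
    unfolding cosang_def abs_divide by (auto intro!: divide_le_eq_1_pos[THEN iffD2] simp: divide_le_eq_1 abs_mult)
qed

text \<open>
  An elastic deflection \<open>u \<mapsto> x u\<close> whose momentum transfer is parallel to \<open>w\<close> is determined
  by \<open>w\<close>: the vector \<open>- x u\<close> is the mirror image of \<open>u\<close> in the line through \<open>w\<close>.
\<close>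
lemma bisector:
  assumes x: "cmod x = 1" and k: "k > 0" and u: "u \<noteq> 0" and eq: "of_real k * w = (1 - x) * u"
    and w: "w \<noteq> 0"
  shows "cosang (x * u) (- w) = cosang w u" "k * cmod w = 2 * cosang w u * cmod u"
proof -
  define r where "r = Re (x * u * cnj u)"
  define N where "N = (cmod u)\<^sup>2"
  have uu: "Re (u * cnj u) = N"
    by (simp add: N_def complex_norm_square[symmetric] flip: of_real_power)
  have xx: "Re (x * u * cnj (x * u)) = N"
    using x unfolding complex_norm_square[symmetric] N_def
    by (simp add: norm_mult flip: of_real_power)
  have kw: "of_real k * w = u - x * u"
    using eq by (simp add: algebra_simps)
  have r': "Re (u * cnj (x * u)) = r"
    by (simp add: r_def algebra_simps)
  \<comment> \<open>The pairings of \<open>k w = u - x u\<close> with \<open>u\<close> and with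
    \<open>- x u\<close> agree. These two vectors have the same length, so \<open>w\<close> makes
    equal angles with them. Step \<open>3\<close> is the squared length of
    \<open>k w\<close>.\<close>
  have 1: "k * Re (w * cnj u) = N - r"
  proof -
    have "k * Re (w * cnj u) = Re (of_real k * w * cnj u)"
      by (simp add: algebra_simps)
    also have "\<dots> = Re (u * cnj u) - Re (x * u * cnj u)"
      unfolding kw by (simp add: algebra_simps)
    finally show ?thesis using uu by (simp add: r_def)
  qed
  have 2: "k * Re (x * u * cnj (- w)) = N - r"
  proof -
    have "k * Re (x * u * cnj (- w)) = - Re (x * u * cnj (of_real k * w))"
      by (simp add: algebra_simps)
    also have "\<dots> = Re (x * u * cnj (x * u)) - Re (x * u * cnj u)"
      unfolding kw by (simp add: algebra_simps)
    finally show ?thesis using xx by (simp add: r_def)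
  qed
  have 3: "(k * cmod w)\<^sup>2 = 2 * (N - r)"
  proof -
    have "(k * cmod w)\<^sup>2 = (cmod (of_real k * w))\<^sup>2"
      using k by (simp add: norm_mult)
    also have "\<dots> = Re ((of_real k * w) * cnj (of_real k * w))"
      by (metis Re_complex_of_real complex_norm_square)
    also have "\<dots> = Re (u * cnj u) - Re (x * u * cnj u) - Re (u * cnj (x * u)) + Re (x * u * cnj (x * u))"
      unfolding kw by (simp add: algebra_simps)
    finally show ?thesis unfolding uu xx r' r_def[symmetric] by simp
  qed
  from 1 2 have "Re (x * u * cnj (- w)) = Re (w * cnj u)"
    using k by (metis less_irrefl mult_left_cancel)
  then show "cosang (x * u) (- w) = cosang w u"
    using x by (simp add: cosang_def norm_mult mult.commute)
  from 1 3 have "k * (k * (cmod w)\<^sup>2) = k * (2 * Re (w * cnj u))"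
    by (simp add: power2_eq_square algebra_simps)
  then have "k * (cmod w)\<^sup>2 = 2 * Re (w * cnj u)"
    using k by simp
  then show "k * cmod w = 2 * cosang w u * cmod u"
    using u w by (simp add: cosang_def field_simps power2_eq_square)
qed

lemma mirror_exists:
  assumes w: "w \<noteq> 0" and u: "u \<noteq> 0"
  obtains x where "cmod x = 1" "(1 - x) * u = of_real (2 * cosang w u * cmod u / cmod w) * w"
proof
  \<comment> \<open>With this factor, \<open>- x * u = w * cnj u / cnj w\<close>, the mirror image
    of \<open>u\<close> in the line through \<open>w\<close>.\<close>
  define x where "x = - (w * cnj u) / (cnj w * u)"
  show "cmod x = 1"
    using w u by (simp add: x_def norm_divide norm_mult)
  have ww: "of_real ((cmod w)\<^sup>2) = w * cnj w"
    by (metis complex_norm_square)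
  have "(1 - x) * u = u + w * cnj u / cnj w"
    using w u by (simp add: x_def field_simps)
  also have "\<dots> = (w * cnj u + cnj (w * cnj u)) / cnj w"
    using w by (simp add: field_simps)
  also have "\<dots> = of_real (2 * Re (w * cnj u)) / cnj w"
    by (simp only: complex_add_cnj)
  also have "\<dots> = of_real (2 * Re (w * cnj u)) / of_real ((cmod w)\<^sup>2) * w"
    using w unfolding ww by (simp add: field_simps)
  also have "\<dots> = of_real (2 * Re (w * cnj u) / (cmod w)\<^sup>2) * w"
    by simp
  also have "2 * Re (w * cnj u) / (cmod w)\<^sup>2 = 2 * cosang w u * cmod u / cmod w"
    using u w by (simp add: cosang_def field_simps power2_eq_square)
  finally show "(1 - x) * u = of_real (2 * cosang w u * cmod u / cmod w) * w" .
qed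

section \<open>The backward recurrence from the capture to the second collision\<close>

text \<open>
  The reciprocals of the distances between particles 2 and 3 at the collisions, numbered backwards
  from the last collision and normalised; \<open>c\<close> is the cosine of the constant turning angle of
  the line through these particles.
\<close>
fun recip_dist :: "(particle \<Rightarrow> real) \<Rightarrow> real \<Rightarrow> nat \<Rightarrow> real" where
  "recip_dist m c 0 = 0"
| "recip_dist m c (Suc 0) = 1"
| "recip_dist m c (Suc (Suc j)) =
    2 * mass_frac m (other (Suc j)) * c * recip_dist m c (Suc j) - recip_dist m c j"

text \<open>Particle 1 is meeting \<open>other j\<close>; \<open>w\<close> and \<open>u\<close> are
  its outgoing velocities relative to that particle and to the next partner
  \<open>other (Suc j)\<close>. The cosine of the angle between these vectors is the same after
  every later collision, so it can be read off here, and the capture at the end forces the ratio of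
  their lengths. Positivity of the terms corresponds to particle 1 always leaving towards its next
  partner.\<close>

lemma captures_alternating:
  assumes pos: "\<And>i. m i > 0"
    and "q P1 = q (other j)" "v P1 \<noteq> v (other j)"
  defines "u \<equiv> v P1 - v (other (Suc j))" and "w \<equiv> v P1 - v (other j)"
  shows "captures m (alternating (Suc j)) q v \<longleftrightarrow>
    (\<exists>s>0. u = of_real s * (q (other (Suc j)) - q (other j))) \<and>
    (\<forall>i\<in>{1..j+2}. recip_dist m (cosang w u) i > 0) \<and>
    cmod w * recip_dist m (cosang w u) (j + 1) = cmod u * recip_dist m (cosang w u) (j + 2)"
  unfolding u_def w_def using assms(2,3)
proof (induction j arbitrary: q v)
  case 0
  define u where "u = v P1 - v P3"
  define w where "w = v P1 - v P2"
  define \<nu> where "\<nu> = mass_frac m P3"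
  have w0: "w \<noteq> 0" using 0 by (simp add: w_def other_def)
  have nu: "\<nu> > 0" using pos by (simp add: \<nu>_def mass_frac_def add_pos_pos)
  have q12: "q P1 = q P2" using 0 by (simp add: other_def)
  have seq: "alternating (Suc 0) = [P2]" "other 0 = P2" "other (Suc 0) = P3"
    by (simp_all add: other_def)
  have "captures m [P2] q v \<longleftrightarrow>
    (\<exists>t x v'. t > 0 \<and> cmod x = 1 \<and> v P1 \<noteq> v P3 \<and> of_real t * u = q P3 - q P1 \<and>
      v' P2 = v P2 \<and> v' P1 - v' P3 = x * u \<and>
      v' P1 - v' P2 = w - of_real \<nu> * (1 - x) * u \<and> v' P1 = v' P2)"
    by (subst captures_Cons[OF pos, of P2 P3]) (simp_all add: captures_Nil u_def w_def \<nu>_def)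
  also have "\<dots> \<longleftrightarrow> (\<exists>t x. t > 0 \<and> cmod x = 1 \<and> u \<noteq> 0 \<and> of_real t * u = q P3 - q P2 \<and>
      w = of_real \<nu> * (1 - x) * u)" (is "?L \<longleftrightarrow> ?R")
  proof
    assume ?L then show ?R using q12 by (force simp: u_def)
  next
    assume ?R
    then obtain t x where h: "t > 0 \<and> cmod x = 1 \<and> u \<noteq> 0 \<and> of_real t * u = q P3 - q P2 \<and>
      w = of_real \<nu> * (1 - x) * u" by blast
    define v' where "v' k = (if k = P3 then v P2 - x * u else v P2)" for k
    show ?L
      using h q12 by (intro exI[of _ t] exI[of _ x] exI[of _ v']) (auto simp: v'_def u_def)
  qed
  also have "\<dots> \<longleftrightarrow> (\<exists>s>0. u = of_real s * (q P3 - q P2)) \<and> u \<noteq> 0 \<and>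
      (\<exists>x. cmod x = 1 \<and> w = of_real \<nu> * (1 - x) * u)"
  proof -
    have "(\<exists>t>0. of_real t * u = d) \<longleftrightarrow> (\<exists>s>0. u = of_real s * d)" for d
    proof
      assume "\<exists>t>0. of_real t * u = d"
      then obtain t where "t > 0" "of_real t * u = d" by blast
      then show "\<exists>s>0. u = of_real s * d"
        by (intro exI[of _ "1 / t"]) auto
    next
      assume "\<exists>s>0. u = of_real s * d"
      then obtain s where "s > 0" "u = of_real s * d" by blast
      then show "\<exists>t>0. of_real t * u = d"
        by (intro exI[of _ "1 / s"]) auto
    qed
    then show ?thesis by blast
  qed
  \<comment> \<open>Equal final velocities mean \<open>w = \<nu> (1 - x) u\<close>, the bisector
    relation with factor \<open>1 / \<nu>\<close>. Its length equation involves \<open>1\<close> and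
    \<open>2 \<nu> c\<close>, the first two positive terms of the recurrence.\<close>
  also have "u \<noteq> 0 \<and> (\<exists>x. cmod x = 1 \<and> w = of_real \<nu> * (1 - x) * u) \<longleftrightarrow>
    cosang w u > 0 \<and> cmod w = cmod u * (2 * \<nu> * cosang w u)" (is "?L \<longleftrightarrow> ?R")
  proof
    assume ?L
    then obtain x where x: "u \<noteq> 0" "cmod x = 1" "w = of_real \<nu> * (1 - x) * u" by blast
    then have "of_real (1 / \<nu>) * w = (1 - x) * u" using nu by simp
    from bisector(2)[OF x(2) _ x(1) this w0] nu have "cmod w = cmod u * (2 * \<nu> * cosang w u)"
      by (simp add: field_simps)
    moreover from this have "cosang w u > 0"
      using w0 x(1) nu by (metis mult_pos_pos zero_less_mult_pos zero_less_norm_iff zero_less_numeral)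
    ultimately show ?R by blast
  next
    assume R: ?R
    then have u0: "u \<noteq> 0" using w0 by auto
    obtain x where x: "cmod x = 1" "(1 - x) * u = of_real (2 * cosang w u * cmod u / cmod w) * w"
      using mirror_exists[OF w0 u0] .
    have "2 * cosang w u * cmod u / cmod w = 1 / \<nu>"
    proof -
      have "cosang w u * cmod u > 0" using R u0 by simp
      then show ?thesis using R nu u0 w0 by (subst conjunct2[OF R]) (simp add: field_simps)
    qed
    then have "w = of_real \<nu> * (1 - x) * u"
      using x(2) nu by (simp add: mult.assoc)
    then show ?L using u0 x by blast
  qed
  also have "cosang w u > 0 \<longleftrightarrow> (\<forall>i\<in>{1..0+2}. recip_dist m (cosang w u) i > 0)"
  proof -
    have "{1..0+2::nat} = {Suc 0, Suc (Suc 0)}" by auto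
    then show ?thesis using nu by (simp add: other_def \<nu>_def[symmetric] zero_less_mult_iff)
  qed
  also have "2 * \<nu> * cosang w u = recip_dist m (cosang w u) (0 + 2)"
    by (simp add: numeral_2_eq_2 other_def \<nu>_def)
  finally show ?case
    by (simp add: seq u_def w_def)
next
  case (Suc j)
  define o' where "o' = other (Suc j)"
  define p where "p = other j"
  define u where "u = v P1 - v p"
  define w where "w = v P1 - v o'"
  define \<nu> where "\<nu> = mass_frac m p"
  define c where "c = cosang w u"
  have ne: "o' \<noteq> P1" "p \<noteq> P1" "p \<noteq> o'" by (simp_all add: o'_def p_def)
  have nu: "\<nu> > 0" using pos by (simp add: \<nu>_def mass_frac_def add_pos_pos)
  have w0: "w \<noteq> 0" using Suc by (simp add: w_def o'_def)
  have q1: "q P1 = q o'" using Suc by (simp add: o'_def)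
  let ?Y = "recip_dist m"
  have rec: "?Y c (j + 3) = 2 * \<nu> * c * ?Y c (j + 2) - ?Y c (j + 1)" for c
    by (simp add: numeral_3_eq_3 \<nu>_def p_def)
  \<comment> \<open>This is the induction hypothesis for the state after the collision. There
    \<open>p\<close> is the particle just met and \<open>o'\<close> the next partner, so the two
    relative velocities exchange their roles.\<close>
  let ?E = "\<lambda>t x v'. (\<exists>s>0. v' P1 - v' o' = of_real s * ((q o' + of_real t * v o') - (q p + of_real t * v p))) \<and>
     (let c = cosang (v' P1 - v' p) (v' P1 - v' o') in
    (\<forall>i\<in>{1..j+2}. ?Y c i > 0) \<and>
    cmod (v' P1 - v' p) * ?Y c (j + 1) = cmod (v' P1 - v' o') * ?Y c (j + 2))"
  have "captures m (alternating (Suc (Suc j))) q v \<longleftrightarrow>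
    (\<exists>t x v'. t > 0 \<and> cmod x = 1 \<and> u \<noteq> 0 \<and> of_real t * u = q p - q P1 \<and>
      v' o' = v o' \<and> v' P1 - v' p = x * u \<and>
      v' P1 - v' o' = w - of_real \<nu> * (1 - x) * u \<and>
      captures m (alternating (Suc j)) (\<lambda>k. q k + of_real t * v k) v')"
    unfolding alternating.simps(2)[of "Suc j"] o'_def[symmetric]
    by (subst captures_Cons[OF pos ne]) (simp_all add: u_def w_def \<nu>_def)
  also have "\<dots> \<longleftrightarrow>
    (\<exists>t x v'. t > 0 \<and> cmod x = 1 \<and> u \<noteq> 0 \<and> of_real t * u = q p - q P1 \<and>
      v' o' = v o' \<and> v' P1 - v' p = x * u \<and>
      v' P1 - v' o' = w - of_real \<nu> * (1 - x) * u \<and> ?E t x v')"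
  proof -
    have "captures m (alternating (Suc j)) (\<lambda>k. q k + of_real t * v k) v' \<longleftrightarrow> ?E t x v'"
      if h: "cmod x = 1" "u \<noteq> 0" "of_real t * u = q p - q P1" "v' P1 - v' p = x * u"
      for t x v'
    proof -
      have "x * u \<noteq> 0" using h by auto
      then have "v' P1 \<noteq> v' p" using h by auto
      moreover have "q P1 + of_real t * v P1 = q p + of_real t * v p"
        using h(3) by (simp add: u_def algebra_simps)
      ultimately show ?thesis
        using Suc.IH[of "\<lambda>k. q k + of_real t * v k" v'] by (simp add: o'_def p_def Let_def)
    qed
    then show ?thesis by (intro ex_cong1) blast
  qed
  also have "\<dots> \<longleftrightarrow> (\<exists>s>0. u = of_real s * (q p - q o')) \<and>
    (\<forall>i\<in>{1..j+3}. ?Y c i > 0) \<and> cmod w * ?Y c (j + 2) = cmod u * ?Y c (j + 3)" (is "?L \<longleftrightarrow> ?R")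
  proof
    assume ?L
    then obtain t x v' s where h: "t > 0" "cmod x = 1" "u \<noteq> 0" "of_real t * u = q p - q P1"
      "v' o' = v o'" "v' P1 - v' p = x * u" "v' P1 - v' o' = w - of_real \<nu> * (1 - x) * u"
      and s: "s > 0" "v' P1 - v' o' = of_real s * ((q o' + of_real t * v o') - (q p + of_real t * v p))"
      and E: "let c = cosang (v' P1 - v' p) (v' P1 - v' o') in
        (\<forall>i\<in>{1..j+2}. ?Y c i > 0) \<and>
         cmod (v' P1 - v' p) * ?Y c (j + 1) = cmod (v' P1 - v' o') * ?Y c (j + 2)"
      by blast
    \<comment> \<open>When particles 1 and \<open>p\<close> meet, \<open>o'\<close> is displaced
      from them by \<open>- t w\<close>. To reach \<open>o'\<close> next, particle 1 must leave with
      velocity \<open>- l w\<close> relative to it, for some \<open>l > 0\<close>.\<close>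
    define l where "l = s * t"
    have l: "l > 0" using s h by (simp add: l_def)
    have "q p + of_real t * v p = q o' + of_real t * v P1"
      using h(4) q1 by (simp add: u_def algebra_simps)
    then have wl: "v' P1 - v' o' = of_real l * (- w)"
      using s(2) by (simp add: l_def w_def algebra_simps)
    have k: "of_real ((1 + l) / \<nu>) * w = (1 - x) * u"
      using wl h(7) nu by (simp add: field_simps)
    have kpos: "(1 + l) / \<nu> > 0" using l nu by simp
    note bis = bisector[OF h(2) kpos h(3) k w0]
    \<comment> \<open>The reflection reproduces the cosine, which is why a single \<open>c\<close>
      serves the whole sequence.\<close>
    have c': "cosang (v' P1 - v' p) (v' P1 - v' o') = c"
      unfolding h(6) wl cosang_scale[OF l] bis(1) by (simp add: c_def)
    have E1: "\<forall>i\<in>{1..j+2}. ?Y c i > 0"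
      and "cmod (v' P1 - v' p) * ?Y c (j + 1) = cmod (v' P1 - v' o') * ?Y c (j + 2)"
      using E unfolding c' Let_def by blast+
    then have E2: "cmod u * ?Y c (j + 1) = l * cmod w * ?Y c (j + 2)"
      unfolding h(6) wl using l h(2) by (simp add: norm_mult)
    have "(1 + l) * cmod w = 2 * \<nu> * c * cmod u"
      using bis(2) nu by (simp add: c_def field_simps)
    then have "(1 + l) * cmod w * ?Y c (j + 2) = 2 * \<nu> * c * cmod u * ?Y c (j + 2)"
      by simp
    then have eq: "cmod w * ?Y c (j + 2) = cmod u * ?Y c (j + 3)"
      unfolding rec using E2 by (simp add: algebra_simps)
    moreover have "cmod w * ?Y c (j + 2) > 0"
      using w0 bspec[OF E1, of "j + 2"] by (intro mult_pos_pos) simp_all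
    ultimately have "?Y c (j + 3) > 0"
      by (metis norm_ge_zero h(3) zero_less_mult_pos zero_less_norm_iff)
    then have "\<forall>i\<in>{1..j+3}. ?Y c i > 0"
      using E1 by (auto simp: le_Suc_eq numeral_3_eq_3 numeral_2_eq_2)
    moreover have "u = of_real (1 / t) * (q p - q o')"
      using h(1,4) q1 by (simp add: field_simps)
    ultimately show ?R
      using eq h(1) by (metis divide_pos_pos zero_less_one)
  next
    assume ?R
    then obtain s where s: "s > 0" "u = of_real s * (q p - q o')"
      and Y: "\<forall>i\<in>{1..j+3}. ?Y c i > 0" and eq: "cmod w * ?Y c (j + 2) = cmod u * ?Y c (j + 3)"
      by blast
    have Y1: "?Y c (j + 1) > 0" and Y2: "?Y c (j + 2) > 0" and Y3: "?Y c (j + 3) > 0"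
      using bspec[OF Y, of "j + 1"] bspec[OF Y, of "j + 2"] bspec[OF Y, of "j + 3"] by simp_all
    have u0: "u \<noteq> 0" using eq w0 Y2 by auto
    obtain x where x: "cmod x = 1" "(1 - x) * u = of_real (2 * cosang w u * cmod u / cmod w) * w"
      using mirror_exists[OF w0 u0] .
    define t where "t = 1 / s"
    \<comment> \<open>The value is forced by \<open>E2\<close>, the condition on the lengths after
      the collision; positive terms of the recurrence make it positive.\<close>
    define l where "l = cmod u * ?Y c (j + 1) / (cmod w * ?Y c (j + 2))"
    have t: "t > 0" "of_real t * u = q p - q P1" using s q1 by (simp_all add: t_def)
    have l: "l > 0" using u0 w0 Y1 Y2 by (simp add: l_def)
    have E2: "cmod u * ?Y c (j + 1) = l * cmod w * ?Y c (j + 2)"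
      using w0 Y2 by (simp add: l_def)
    have "(1 + l) * cmod w * ?Y c (j + 2) = 2 * \<nu> * c * cmod u * ?Y c (j + 2)"
      using eq E2 unfolding rec by (simp add: algebra_simps)
    then have "(1 + l) * cmod w = 2 * \<nu> * c * cmod u"
      using Y2 by simp
    then have kk: "2 * cosang w u * cmod u / cmod w = (1 + l) / \<nu>"
      using w0 nu by (simp add: c_def field_simps)
    have k: "of_real ((1 + l) / \<nu>) * w = (1 - x) * u" using x(2) unfolding kk by simp
    have kpos: "(1 + l) / \<nu> > 0" using l nu by simp
    note bis = bisector[OF x(1) kpos u0 k w0]
    define v' where "v' k = (if k = o' then v o' else if k = P1 then v o' - of_real l * w
      else v o' - of_real l * w - x * u)" for k
    have v': "v' o' = v o'" "v' P1 - v' o' = of_real l * (- w)" "v' P1 - v' p = x * u"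
      using ne by (auto simp: v'_def)
    have "of_real \<nu> * (1 - x) * u = (1 + of_real l) * w"
      using k nu by (simp add: field_simps)
    then have wl: "v' P1 - v' o' = w - of_real \<nu> * (1 - x) * u"
      unfolding v'(2,3) by (simp add: algebra_simps)
    have c': "cosang (v' P1 - v' p) (v' P1 - v' o') = c"
      unfolding v'(2,3) cosang_scale[OF l] bis(1) by (simp add: c_def)
    have "q p + of_real t * v p = q o' + of_real t * v P1"
      using t(2) q1 by (simp add: u_def algebra_simps)
    then have D: "v' P1 - v' o' = of_real (l / t) * ((q o' + of_real t * v o') - (q p + of_real t * v p))"
      unfolding v'(2,3) using t(1) by (simp add: w_def field_simps)
    have "?E t x v'"
      unfolding c' Let_def
    proof (intro conjI)
      show "\<exists>s>0. v' P1 - v' o' = of_real s * ((q o' + of_real t * v o') - (q p + of_real t * v p))"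
        using D l t(1) by (meson divide_pos_pos)
      show "\<forall>i\<in>{1..j + 2}. 0 < ?Y c i" using Y by auto
      show "cmod (v' P1 - v' p) * ?Y c (j + 1) = cmod (v' P1 - v' o') * ?Y c (j + 2)"
        unfolding v'(2,3) using E2 l x(1) by (simp add: norm_mult)
    qed
    then show ?L using t x(1) u0 v'(1,3) wl by blast
  qed
  finally show ?case
    by (simp add: o'_def p_def u_def w_def c_def numeral_3_eq_3)
qed

section \<open>The first collision, with particles 2 and 3 at rest\<close>

lemma mass_frac_bounds:
  assumes "\<And>i. m i > (0::real)"
  shows "0 < mass_frac m i" "mass_frac m i < 1"
  using assms[of P1] assms[of i] by (simp_all add: mass_frac_def add_pos_pos)

text \<open>The equation is the law of cosines for the sum of the vectors \<open>1 - \<mu>\<close>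
  and \<open>\<mu> x\<close>, when this sum has length \<open>z\<close> and makes an angle of cosine
  \<open>c\<close> with \<open>x\<close>.\<close>

lemma first_collision_exists:
  fixes \<mu> z c :: real
  assumes "\<mu> < 1" "z > 0" "\<bar>c\<bar> \<le> 1" and eq: "z\<^sup>2 - 2 * \<mu> * c * z = 1 - 2 * \<mu>"
  obtains x where "cmod x = 1" "cmod (of_real (1 - \<mu>) + of_real \<mu> * x) = z" "cosang x (of_real (1 - \<mu>) + of_real \<mu> * x) = c"
proof
  \<comment> \<open>Dividing the sum by \<open>x\<close> should give \<open>z e\<close>, where
    \<open>e\<close> is a unit vector of real part \<open>c\<close>. Then
    \<open>d = z e - \<mu>\<close> must be \<open>(1 - \<mu>) / x\<close>; the law of cosines gives
    it the right length, and \<open>x\<close> is obtained by solving for it.\<close>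
  define e where "e = Complex c (sqrt (1 - c\<^sup>2))"
  have "c\<^sup>2 \<le> 1" using assms(3) by (simp add: abs_square_le_1)
  then have e: "cmod e = 1" "Re e = c" "(Im e)\<^sup>2 = 1 - c\<^sup>2"
    by (simp_all add: e_def cmod_def)
  define d where "d = z * e - \<mu>"
  have "(cmod d)\<^sup>2 = (z * c - \<mu>)\<^sup>2 + z\<^sup>2 * (Im e)\<^sup>2"
    by (simp add: d_def cmod_power2 e(2) power_mult_distrib)
  also have "\<dots> = (1 - \<mu>)\<^sup>2"
    unfolding e(3) using eq by (simp add: power2_eq_square algebra_simps)
  finally have d: "cmod d = 1 - \<mu>" using assms(1) by (simp add: power2_eq_iff_nonneg)
  then have d0: "d \<noteq> 0" using assms(1) by auto
  define x where "x = (1 - \<mu>) / d"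
  show x: "cmod x = 1" using d assms(1) unfolding x_def norm_divide
    by (metis abs_of_pos diff_gt_0_iff_gt div_self less_irrefl norm_of_real of_real_1 of_real_diff)
  have sum: "of_real (1 - \<mu>) + of_real \<mu> * x = z * (e * x)"
    using d0 by (simp add: x_def d_def field_simps)
  show "cmod (of_real (1 - \<mu>) + of_real \<mu> * x) = z"
    unfolding sum using x e assms(2) by (simp add: norm_mult)
  have "x * cnj (e * x) = cnj e * (x * cnj x)" by simp
  also have "\<dots> = cnj e" using x by (simp add: complex_norm_square[symmetric] del: complex_cnj_mult)
  finally have cross: "x * cnj (e * x) = cnj e" .
  show "cosang x (of_real (1 - \<mu>) + of_real \<mu> * x) = c"
    unfolding sum cosang_scale[OF assms(2)] using cross x e by (simp add: cosang_def norm_mult del: times_complex.sel complex_cnj_mult)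
qed

lemma first_collision_eq:
  fixes \<mu> :: real and x :: complex
  assumes "cmod x = 1" and z: "of_real (1 - \<mu>) + of_real \<mu> * x \<noteq> 0"
  defines "z \<equiv> cmod (of_real (1 - \<mu>) + of_real \<mu> * x)" and "c \<equiv> cosang x (of_real (1 - \<mu>) + of_real \<mu> * x)"
  shows "z\<^sup>2 - 2 * \<mu> * c * z = 1 - 2 * \<mu>"
proof -
  have x1: "(Re x)\<^sup>2 + (Im x)\<^sup>2 = 1" using assms(1) by (metis cmod_power2 one_power2)
  have zz: "z\<^sup>2 = (1 - \<mu> + \<mu> * Re x)\<^sup>2 + \<mu>\<^sup>2 * (Im x)\<^sup>2"
    by (simp add: z_def cmod_power2 power_mult_distrib)
  have cz: "c * z = Re x * (1 - \<mu> + \<mu> * Re x) + \<mu> * (Im x)\<^sup>2"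
    using z assms(1) by (simp add: z_def c_def cosang_def power2_eq_square)
  have "z\<^sup>2 - 2 * \<mu> * (c * z) = (1 - \<mu>)\<^sup>2 - \<mu>\<^sup>2 * ((Re x)\<^sup>2 + (Im x)\<^sup>2)"
    unfolding zz cz by (simp add: power2_eq_square algebra_simps)
  then show ?thesis unfolding x1 by (simp add: power2_eq_square algebra_simps)
qed

text \<open>A first collision at velocity \<open>V\<close> leaves particle 1 with velocity
  \<open>x V\<close> relative to particle 3 and \<open>(1 - \<mu> + \<mu> x) V\<close> relative to
  particle 2. The later collisions prescribe the ratio of the lengths of these vectors in terms of
  the cosine \<open>c\<close> of their angle; the law of cosines, cleared of denominators, says when
  some \<open>x\<close> achieves both.\<close>

lemma capture_process_iff_recip_dist:
  assumes pos: "\<And>i. m i > 0" and n: "n \<ge> 1"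
  defines "\<mu> \<equiv> mass_frac m P3"
  shows "capture_process m (capture_sequence n) \<longleftrightarrow>
    (\<exists>c. \<bar>c\<bar> \<le> 1 \<and> (\<forall>i\<in>{1..2 * n + 1}. recip_dist m c i > 0) \<and>
      (recip_dist m c (2 * n))\<^sup>2 - 2 * \<mu> * c * recip_dist m c (2 * n) * recip_dist m c (2 * n + 1) =
      (1 - 2 * \<mu>) * (recip_dist m c (2 * n + 1))\<^sup>2)" (is "_ \<longleftrightarrow> ?R")
proof -
  let ?Y = "recip_dist m"
  have mu: "0 < \<mu>" "\<mu> < 1" using mass_frac_bounds[of m, OF pos] by (simp_all add: \<mu>_def)
  define j where "j = 2 * n - 1"
  have j: "2 * n = Suc j" "2 * n + 1 = j + 2" "odd j" using n by (auto simp: j_def)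
  have oj: "other j = P3" "other (Suc j) = P2" using j(3) by (simp_all add: other_def)
  have seq: "capture_sequence n = P2 # alternating (Suc j)"
    unfolding capture_sequence_eq j(1) oj ..
  define G where "G q v \<longleftrightarrow> (\<exists>s>0. v P1 - v P2 = of_real s * (q P2 - q P3)) \<and>
    (let w = v P1 - v P3; u = v P1 - v P2; c = cosang w u in
    (\<forall>i\<in>{1..2*n+1}. ?Y c i > 0) \<and> cmod w * ?Y c (2*n) = cmod u * ?Y c (2*n+1))"
    for q v :: "particle \<Rightarrow> complex"
  have later: "captures m (alternating (Suc j)) q v \<longleftrightarrow> G q v"
    if "q P1 = q P3" "v P1 \<noteq> v P3" for q v
    using captures_alternating[OF pos, of q j v] that unfolding G_def oj j(2) Let_def
    by (simp add: j(1))
  have cap: "captures m (P2 # alternating (Suc j)) q v \<longleftrightarrow>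
    (\<exists>t x v'. t > 0 \<and> cmod x = 1 \<and> of_real t * V = q P3 - q P1 \<and>
      v' P2 = 0 \<and> v' P1 - v' P3 = x * V \<and>
      v' P1 - v' P2 = (of_real (1 - \<mu>) + of_real \<mu> * x) * V \<and>
      G (\<lambda>k. q k + of_real t * v k) v')"
    if v: "v P1 = V" "v P2 = 0" "v P3 = 0" and V: "V \<noteq> 0"
    for q v :: "particle \<Rightarrow> complex" and V :: complex
  proof -
    have alg: "V - of_real \<mu> * (1 - x) * V = (of_real (1 - \<mu>) + of_real \<mu> * x) * V" for x :: complex
      by (simp add: algebra_simps)
    have "captures m (P2 # alternating (Suc j)) q v \<longleftrightarrow>
      (\<exists>t x v'. t > 0 \<and> cmod x = 1 \<and> of_real t * V = q P3 - q P1 \<and>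
      v' P2 = 0 \<and> v' P1 - v' P3 = x * V \<and>
      v' P1 - v' P2 = (of_real (1 - \<mu>) + of_real \<mu> * x) * V \<and>
      captures m (alternating (Suc j)) (\<lambda>k. q k + of_real t * v k) v')"
      by (subst captures_Cons[OF pos, of P2 P3]) (use v V in \<open>simp_all add: \<mu>_def[symmetric] alg\<close>)
    also have "\<dots> \<longleftrightarrow> (\<exists>t x v'. t > 0 \<and> cmod x = 1 \<and> of_real t * V = q P3 - q P1 \<and>
      v' P2 = 0 \<and> v' P1 - v' P3 = x * V \<and>
      v' P1 - v' P2 = (of_real (1 - \<mu>) + of_real \<mu> * x) * V \<and>
      G (\<lambda>k. q k + of_real t * v k) v')"
    proof -
      have "captures m (alternating (Suc j)) (\<lambda>k. q k + of_real t * v k) v' \<longleftrightarrow>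
        G (\<lambda>k. q k + of_real t * v k) v'"
        if "cmod x = 1" "of_real t * V = q P3 - q P1" "v' P1 - v' P3 = x * V" for t x v'
      proof (rule later)
        show "q P1 + of_real t * v P1 = q P3 + of_real t * v P3" using that v by simp
        have "x * V \<noteq> 0" using that V by auto
        then show "v' P1 \<noteq> v' P3" using that(3) by auto
      qed
      then show ?thesis by (intro ex_cong1) blast
    qed
    finally show ?thesis .
  qed
  have sp: "capture_process m (capture_sequence n) \<longleftrightarrow>
    (\<exists>q v. q P2 \<noteq> q P3 \<and> v P2 = 0 \<and> v P3 = 0 \<and> v P1 \<noteq> 0 \<and>
      captures m (P2 # alternating (Suc j)) q v)"
    unfolding capture_process_def captures_def seq by blast
  show ?thesis
  proof
    assume "capture_process m (capture_sequence n)"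
    then obtain q v where qv: "v P2 = 0" "v P3 = 0" "v P1 \<noteq> 0"
      "captures m (P2 # alternating (Suc j)) q v" unfolding sp by blast
    define V where "V = v P1"
    have V: "V \<noteq> 0" using qv by (simp add: V_def)
    from cap[OF V_def[symmetric] qv(1,2) V] qv(4) obtain t x v' where
      h: "cmod x = 1" "v' P1 - v' P3 = x * V" "v' P1 - v' P2 = (of_real (1 - \<mu>) + of_real \<mu> * x) * V"
        "G (\<lambda>k. q k + of_real t * v k) v'" by blast
    define c where "c = cosang (x * V) ((of_real (1 - \<mu>) + of_real \<mu> * x) * V)"
    have Y: "\<forall>i\<in>{1..2*n+1}. ?Y c i > 0"
      and eq: "cmod (x * V) * ?Y c (2*n) = cmod ((of_real (1 - \<mu>) + of_real \<mu> * x) * V) * ?Y c (2*n+1)"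
      using h(4) unfolding G_def Let_def h(2,3) c_def by blast+
    have Y0: "?Y c (2*n) > 0" "?Y c (2*n+1) > 0" using Y n by auto
    define z where "z = cmod (of_real (1 - \<mu>) + of_real \<mu> * x)"
    have z: "?Y c (2*n) = z * ?Y c (2*n+1)"
      using eq V h(1) by (simp add: norm_mult z_def)
    have z0: "of_real (1 - \<mu>) + of_real \<mu> * x \<noteq> 0" using z Y0 by (auto simp: z_def)
    have c: "c = cosang x (of_real (1 - \<mu>) + of_real \<mu> * x)"
    proof -
      have "x * V * cnj ((of_real (1 - \<mu>) + of_real \<mu> * x) * V) = (V * cnj V) * (x * cnj (of_real (1 - \<mu>) + of_real \<mu> * x))"
        by (simp add: algebra_simps)
      also have "\<dots> = of_real ((cmod V)\<^sup>2) * (x * cnj (of_real (1 - \<mu>) + of_real \<mu> * x))"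
        by (metis complex_norm_square)
      finally have "Re (x * V * cnj ((of_real (1 - \<mu>) + of_real \<mu> * x) * V)) = (cmod V)\<^sup>2 * Re (x * cnj (of_real (1 - \<mu>) + of_real \<mu> * x))"
        by (metis Re_complex_of_real Im_complex_of_real diff_zero mult_zero_left times_complex.sel(1))
      then show ?thesis using V unfolding c_def cosang_def norm_mult
        by (simp add: power2_eq_square del: times_complex.sel)
    qed
    have "z\<^sup>2 - 2 * \<mu> * c * z = 1 - 2 * \<mu>"
      using first_collision_eq[OF h(1) z0] by (simp add: z_def c)
    then have "(z\<^sup>2 - 2 * \<mu> * c * z) * (?Y c (2*n+1))\<^sup>2 = (1 - 2 * \<mu>) * (?Y c (2*n+1))\<^sup>2"
      by simp
    then have "(?Y c (2 * n))\<^sup>2 - 2 * \<mu> * c * ?Y c (2 * n) * ?Y c (2 * n + 1) =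
      (1 - 2 * \<mu>) * (?Y c (2 * n + 1))\<^sup>2"
      unfolding z by (simp add: power2_eq_square algebra_simps)
    moreover have "\<bar>c\<bar> \<le> 1" unfolding c by (rule abs_cosang_le_1)
    ultimately show ?R using Y by blast
  next
    assume ?R
    then obtain c where c: "\<bar>c\<bar> \<le> 1" and Y: "\<forall>i\<in>{1..2*n+1}. ?Y c i > 0"
      and eq: "(?Y c (2 * n))\<^sup>2 - 2 * \<mu> * c * ?Y c (2 * n) * ?Y c (2 * n + 1) =
      (1 - 2 * \<mu>) * (?Y c (2 * n + 1))\<^sup>2" by blast
    have Y0: "?Y c (2*n) > 0" "?Y c (2*n+1) > 0" using Y n by auto
    define z where "z = ?Y c (2*n) / ?Y c (2*n+1)"
    have z: "z > 0" "?Y c (2*n) = z * ?Y c (2*n+1)" using Y0 by (simp_all add: z_def)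
    have "(z\<^sup>2 - 2 * \<mu> * c * z) * (?Y c (2*n+1))\<^sup>2 = (1 - 2 * \<mu>) * (?Y c (2*n+1))\<^sup>2"
      using eq unfolding z(2) by (simp add: power2_eq_square algebra_simps)
    then have "z\<^sup>2 - 2 * \<mu> * c * z = 1 - 2 * \<mu>" using Y0 by simp
    then obtain x where x: "cmod x = 1" "cmod (of_real (1 - \<mu>) + of_real \<mu> * x) = z" "cosang x (of_real (1 - \<mu>) + of_real \<mu> * x) = c"
      using first_collision_exists[OF mu(2) z(1) c] by metis
    define u where "u = of_real (1 - \<mu>) + of_real \<mu> * x"
    have u0: "u \<noteq> 0" using x(2) z(1) by (auto simp: u_def)
    \<comment> \<open>Particle 1 starts at \<open>-1\<close> with velocity \<open>1\<close> and
      meets particle 3 at the origin after time \<open>1\<close>. Particle 2 waits at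
      \<open>u\<close>, straight ahead of particle 1 as it leaves with velocity
      \<open>u\<close>.\<close>
    define q where "q k = (case k of P1 \<Rightarrow> - 1 | P2 \<Rightarrow> u | P3 \<Rightarrow> 0)" for k
    define v :: "particle \<Rightarrow> complex" where "v k = (if k = P1 then 1 else 0)" for k
    define v' where "v' k = (case k of P1 \<Rightarrow> u | P2 \<Rightarrow> 0 | P3 \<Rightarrow> u - x)" for k
    have "G (\<lambda>k. q k + of_real 1 * v k) v'"
      unfolding G_def Let_def
    proof (intro conjI)
      show "\<exists>s>0. v' P1 - v' P2 = complex_of_real s *
        (q P2 + complex_of_real 1 * v P2 - (q P3 + complex_of_real 1 * v P3))"
        by (intro exI[of _ 1]) (simp add: v'_def q_def v_def)
      show "\<forall>i\<in>{1..2 * n + 1}. 0 < ?Y (cosang (v' P1 - v' P3) (v' P1 - v' P2)) i"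
        using Y x(3) by (simp add: v'_def u_def)
      show "cmod (v' P1 - v' P3) * ?Y (cosang (v' P1 - v' P3) (v' P1 - v' P2)) (2 * n) =
        cmod (v' P1 - v' P2) * ?Y (cosang (v' P1 - v' P3) (v' P1 - v' P2)) (2 * n + 1)"
        using x z(2) by (simp add: v'_def u_def)
    qed
    then have "captures m (P2 # alternating (Suc j)) q v"
      by (subst cap[of v 1]) (use x in \<open>auto intro!: exI[of _ "1::real"] exI[of _ x] exI[of _ v'] simp: v_def v'_def q_def u_def\<close>)
    then show "capture_process m (capture_sequence n)"
      unfolding sp using u0 by (intro exI[of _ q] exI[of _ v]) (simp add: q_def v_def)
  qed
qed

section \<open>Monotonicity of trigonometric quotients\<close>

text \<open>The numerator \<open>N\<close> of the derivative vanishes at \<open>0\<close> and has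
  itself a negative derivative, a negative multiple of \<open>sin (q t) sin (p t)\<close>. The sign
  of \<open>sin (q t)\<close> matters only for \<open>t < y\<close>, so \<open>q y = pi\<close> is
  allowed.\<close>

lemma sin_ratio_decreasing:
  fixes p q x y :: real
  assumes "0 < p" "p < q" "0 < x" "x < y" "q * y \<le> pi"
  shows "sin (q * y) / sin (p * y) < sin (q * x) / sin (p * x)"
proof -
  have sinp: "sin (p * t) > 0" and sinq: "0 < t \<Longrightarrow> t < y \<Longrightarrow> sin (q * t) > 0" if "0 < t" "t \<le> y" for t
  proof -
    have "p * t < q * t" using assms that by simp
    also have "q * t \<le> q * y" using assms that by simp
    finally show "sin (p * t) > 0" using assms that by (intro sin_gt_zero) auto
    assume "t < y"
    then have "q * t < q * y" using assms by simp
    also note \<open>q * y \<le> pi\<close>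
    finally show "sin (q * t) > 0" using assms that by (intro sin_gt_zero) auto
  qed
  define N where "N t = q * cos (q * t) * sin (p * t) - p * sin (q * t) * cos (p * t)" for t
  have dN: "(N has_real_derivative - (q\<^sup>2 - p\<^sup>2) * (sin (q * t) * sin (p * t))) (at t)" for t
    unfolding N_def by (auto intro!: derivative_eq_intros simp: algebra_simps power2_eq_square)
  have Nneg: "N t < 0" if t: "0 < t" "t \<le> y" for t
  proof -
    have "N t < N 0"
    proof (rule DERIV_neg_imp_decreasing_open[OF t(1)])
      fix z assume z: "0 < z" "z < t"
      have "q\<^sup>2 > p\<^sup>2" using assms by (simp add: power_strict_mono)
      moreover have "sin (q * z) * sin (p * z) > 0" using z t sinp sinq by simp
      ultimately show "\<exists>d. (N has_real_derivative d) (at z) \<and> d < 0"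
        using dN[of z] by (metis diff_gt_0_iff_gt mult_minus_left mult_pos_pos neg_less_0_iff_less)
    next
      show "continuous_on {0..t} N" unfolding N_def by (intro continuous_intros)
    qed
    then show ?thesis by (simp add: N_def)
  qed
  show ?thesis
  proof (rule DERIV_neg_imp_decreasing[OF assms(4)])
    fix t assume t: "x \<le> t" "t \<le> y"
    then have t0: "0 < t" using assms by simp
    have "((\<lambda>t. sin (q * t) / sin (p * t)) has_real_derivative N t / (sin (p * t))\<^sup>2) (at t)"
      unfolding N_def using sinp[OF t0 t(2)]
      by (auto intro!: derivative_eq_intros simp: power2_eq_square algebra_simps)
    moreover have "N t / (sin (p * t))\<^sup>2 < 0"
      using Nneg[OF t0 t(2)] sinp[OF t0 t(2)] by (simp add: divide_neg_pos)
    ultimately show "\<exists>d. ((\<lambda>t. sin (q * t) / sin (p * t)) has_real_derivative d) (at t) \<and> d < 0"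
      by blast
  qed
qed

text \<open>With \<open>r = tan t / tan (N t)\<close>, the quotient
  \<open>sin ((N + 1) t) / sin ((N - 1) t)\<close> is \<open>(1 + r) / (1 - r)\<close>, which
  reduces the claim to \<open>sin_ratio_decreasing\<close>. The argument \<open>N t\<close> may pass
  \<open>pi / 2\<close>; there \<open>tan\<close> is \<open>0\<close> by convention and
  \<open>r\<close> still has its limiting value \<open>0\<close>.\<close>

lemma tan_cot_decreasing:
  fixes N x y :: real
  assumes N: "N > 1" and xy: "0 < x" "x < y" "(N + 1) * y \<le> pi"
  shows "tan y / tan (N * y) < tan x / tan (N * x)"
proof -
  have bd: "0 < N * t" "N * t < pi" "0 < t" "t < pi / 2" "sin ((N - 1) * t) > 0" if "x \<le> t" "t \<le> y" for t
  proof -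
    have le: "(N + 1) * t \<le> pi" using that xy N by (smt (verit) mult_left_mono)
    show t0: "0 < t" using that xy by simp
    then show "0 < N * t" using N by simp
    show "N * t < pi" using le t0 by (simp add: algebra_simps)
    have "N * t > t" using N t0 by simp
    with le show "t < pi / 2" by (simp add: algebra_simps)
    show "sin ((N - 1) * t) > 0"
      using le t0 N by (intro sin_gt_zero) (auto simp: algebra_simps)
  qed
  have S: "sin ((N + 1) * t) = sin (N * t) * cos t + cos (N * t) * sin t"
      "sin ((N - 1) * t) = sin (N * t) * cos t - cos (N * t) * sin t" for t
    by (simp_all add: algebra_simps sin_add sin_diff)
  have "sin ((N + 1) * y) / sin ((N - 1) * y) < sin ((N + 1) * x) / sin ((N - 1) * x)"
    using assms by (intro sin_ratio_decreasing) auto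
  then have "sin ((N + 1) * y) * sin ((N - 1) * x) < sin ((N + 1) * x) * sin ((N - 1) * y)"
    using bd(5)[of x] bd(5)[of y] xy by (simp add: field_simps)
  then have "(sin y * cos (N * y)) * (cos x * sin (N * x)) < (sin x * cos (N * x)) * (cos y * sin (N * y))"
    unfolding S by (simp add: algebra_simps)
  moreover have "cos x * sin (N * x) > 0" "cos y * sin (N * y) > 0"
    using bd[of x] bd[of y] xy by (auto intro!: mult_pos_pos cos_gt_zero_pi sin_gt_zero)
  ultimately have "(sin y * cos (N * y)) / (cos y * sin (N * y)) < (sin x * cos (N * x)) / (cos x * sin (N * x))"
    by (simp add: field_simps)
  then show ?thesis by (simp add: tan_def)
qed

section \<open>Admissible angles\<close>

text \<open>The coefficients of the recurrence alternate between \<open>2 p^2 c\<close> and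
  \<open>2 r^2 c\<close>. Taking the factor \<open>p / r\<close> out of the terms of even index
  turns both into \<open>2 p r c = 2 cos t\<close>, and the recurrence of \<open>sin (i t)\<close>
  remains.\<close>

lemma recip_dist_closed_form:
  assumes \<mu>: "mass_frac m P3 = p\<^sup>2" "mass_frac m P2 = r\<^sup>2" and pr: "p > 0" "r > 0"
    and c: "cos t = c * p * r" and t: "sin t > 0"
  shows "recip_dist m c i = (if odd i then 1 else p / r) * (sin (real i * t) / sin t)"
proof (induction i rule: induct_nat_012)
  case 0
  then show ?case by simp
next
  case 1
  then show ?case using t by simp
next
  case (ge2 j)
  have rec: "sin (real (Suc (Suc j)) * t) = 2 * cos t * sin (real (Suc j) * t) - sin (real j * t)"
  proof -
    have "sin (real (Suc j) * t + t) + sin (real (Suc j) * t - t) = 2 * cos t * sin (real (Suc j) * t)"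
      unfolding sin_add sin_diff by simp
    then show ?thesis by (simp add: algebra_simps)
  qed
  show ?case
  proof (cases "even j")
    case True
    then have "recip_dist m c (Suc (Suc j)) =
        2 * p\<^sup>2 * c * (sin (real (Suc j) * t) / sin t) - p / r * (sin (real j * t) / sin t)"
      using ge2 \<mu> by (simp add: other_def)
    also have "2 * p\<^sup>2 * c = p / r * (2 * cos t)"
      using pr unfolding c by (simp add: power2_eq_square)
    also have "p / r * (2 * cos t) * (sin (real (Suc j) * t) / sin t) - p / r * (sin (real j * t) / sin t)
        = p / r * (sin (real (Suc (Suc j)) * t) / sin t)"
      unfolding rec by (simp add: diff_divide_distrib right_diff_distrib)
    finally show ?thesis using True by simp
  next
    case False
    then have "recip_dist m c (Suc (Suc j)) =
        2 * r\<^sup>2 * c * (p / r * (sin (real (Suc j) * t) / sin t)) - sin (real j * t) / sin t"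
      using ge2 \<mu> by (simp add: other_def)
    also have "2 * r\<^sup>2 * c * (p / r * (sin (real (Suc j) * t) / sin t)) = 2 * cos t * (sin (real (Suc j) * t) / sin t)"
      using pr unfolding c by (simp add: power2_eq_square)
    also have "2 * cos t * (sin (real (Suc j) * t) / sin t) - sin (real j * t) / sin t
        = sin (real (Suc (Suc j)) * t) / sin t"
      unfolding rec by (simp add: diff_divide_distrib)
    finally show ?thesis using False by simp
  qed
qed

text \<open>The steps have length at most \<open>pi / 2\<close>, so the first multiple of
  \<open>t\<close> to reach \<open>pi\<close> is still below \<open>2 pi\<close>, where the sine is
  not positive.\<close>

lemma sin_positive_iff_less_pi:
  assumes "0 < t" "t \<le> pi / 2"
  shows "(\<forall>i\<in>{1..N::nat}. sin (real i * t) > 0) \<longleftrightarrow> real N * t < pi"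
proof
  assume R: "real N * t < pi"
  show "\<forall>i\<in>{1..N}. sin (real i * t) > 0"
  proof
    fix i assume i: "i \<in> {1..N}"
    have "real i * t \<le> real N * t" using i assms by simp
    then have "real i * t < pi" using R by linarith
    then show "sin (real i * t) > 0" using i assms by (intro sin_gt_zero) auto
  qed
next
  assume L: "\<forall>i\<in>{1..N}. sin (real i * t) > 0"
  have "i \<le> N \<Longrightarrow> real i * t < pi" for i
  proof (induction i)
    case (Suc i)
    then have i: "real i * t < pi" by simp
    show ?case
    proof (rule ccontr)
      assume "\<not> ?thesis"
      then have "pi \<le> real (Suc i) * t" by simp
      moreover have "real (Suc i) * t = real i * t + t" by (simp add: distrib_right)
      then have "real (Suc i) * t < 2 * pi" using i assms by linarith
      ultimately have "sin (real (Suc i) * t) \<le> 0" by (intro sin_le_zero)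
      then show False using bspec[OF L, of "Suc i"] Suc.prems by simp
    qed
  qed simp
  then show "real N * t < pi" by simp
qed

text \<open>Since \<open>cos t = c cos \<phi>\<close>, the bound \<open>c \<le> 1\<close> becomes
  \<open>\<phi> \<le> t\<close>. Positivity of the terms becomes \<open>(2 n + 1) t < pi\<close>,
  and the constant \<open>K\<close> is chosen so that the condition on the first collision becomes
  the equation between sines.\<close>

lemma capture_process_iff_angle:
  assumes pos: "\<And>i. m i > 0" and n: "n \<ge> 1"
  defines "\<mu> \<equiv> mass_frac m P3" and "\<nu> \<equiv> mass_frac m P2"
  assumes \<phi>: "0 < \<phi>" "\<phi> < pi / 2" "(cos \<phi>)\<^sup>2 = \<mu> * \<nu>"
    and K: "K > 0" "K\<^sup>2 * (\<mu> + \<nu> - 2 * \<mu> * \<nu>) = \<mu>"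
  shows "capture_process m (capture_sequence n) \<longleftrightarrow>
    (\<exists>t. \<phi> \<le> t \<and> (2 * real n + 1) * t < pi \<and> sin ((2 * real n + 1) * t) = K * sin t)"
proof -
  let ?N = "2 * real n + 1"
  have mu: "0 < \<mu>" "\<mu> < 1" "0 < \<nu>" "\<nu> < 1"
    using mass_frac_bounds[of m, OF pos] by (simp_all add: \<mu>_def \<nu>_def)
  define p r where "p = sqrt \<mu>" and "r = sqrt \<nu>"
  have pr: "p > 0" "r > 0" "mass_frac m P3 = p\<^sup>2" "mass_frac m P2 = r\<^sup>2" "\<mu> = p\<^sup>2" "\<nu> = r\<^sup>2"
    using mu by (simp_all add: p_def r_def \<mu>_def \<nu>_def)
  have cos\<phi>: "cos \<phi> = p * r"
  proof (rule power2_eq_imp_eq)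
    show "(cos \<phi>)\<^sup>2 = (p * r)\<^sup>2" using \<phi>(3) pr by (simp add: power_mult_distrib)
    show "cos \<phi> \<ge> 0" using \<phi> by (intro cos_ge_zero) auto
    show "p * r \<ge> 0" using pr by simp
  qed
  have key: "(\<forall>i\<in>{1..2 * n + 1}. recip_dist m c i > 0) \<and>
      (recip_dist m c (2 * n))\<^sup>2 - 2 * \<mu> * c * recip_dist m c (2 * n) * recip_dist m c (2 * n + 1) =
      (1 - 2 * \<mu>) * (recip_dist m c (2 * n + 1))\<^sup>2 \<longleftrightarrow>
      ?N * t < pi \<and> sin (?N * t) = K * sin t"
    if t: "0 < t" "t \<le> pi / 2" and c: "cos t = c * p * r" for t c
  proof -
    have st: "sin t > 0" using t by (intro sin_gt_zero) auto
    note form = recip_dist_closed_form[OF pr(3,4,1,2) c st]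
    have sign: "0 < f * (s / sin t) \<longleftrightarrow> 0 < s" if "f > 0" for f s
      using that st by (simp add: zero_less_mult_iff zero_less_divide_iff)
    have "recip_dist m c i > 0 \<longleftrightarrow> sin (real i * t) > 0" for i
      unfolding form by (intro sign) (use pr in auto)
    then have "(\<forall>i\<in>{1..2 * n + 1}. recip_dist m c i > 0) \<longleftrightarrow> real (2 * n + 1) * t < pi"
      using sin_positive_iff_less_pi[OF t] by simp
    also have "real (2 * n + 1) = ?N" by simp
    finally have P: "(\<forall>i\<in>{1..2 * n + 1}. recip_dist m c i > 0) \<longleftrightarrow> ?N * t < pi" .
    have E: "(recip_dist m c (2 * n))\<^sup>2 - 2 * \<mu> * c * recip_dist m c (2 * n) * recip_dist m c (2 * n + 1) =
      (1 - 2 * \<mu>) * (recip_dist m c (2 * n + 1))\<^sup>2 \<longleftrightarrow> sin (?N * t) = K * sin t" (is "?L = ?A \<longleftrightarrow> _")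
      if less: "?N * t < pi"
    proof -
      define S S' where "S = sin (?N * t)" and "S' = sin (2 * real n * t)"
      have "?N * t > 0" using t by simp
      then have S0: "S > 0" using less unfolding S_def by (intro sin_gt_zero)
      have "S' = S * cos t - cos (?N * t) * sin t"
        unfolding S'_def S_def sin_diff[symmetric] by (simp add: algebra_simps)
      then have "(S' - S * cos t)\<^sup>2 = (cos (?N * t))\<^sup>2 * (sin t)\<^sup>2"
        by (simp add: power_mult_distrib)
      also have "\<dots> = (1 - S\<^sup>2) * (sin t)\<^sup>2"
        by (simp add: S_def cos_squared_eq)
      \<comment> \<open>This is the law of cosines in the triangle with angles \<open>t\<close>,
        \<open>2 n t\<close> and \<open>pi - (2 n + 1) t\<close>, whose sides are the sines of these
        angles.\<close>
      finally have id: "S'\<^sup>2 - 2 * cos t * S' * S = (sin t)\<^sup>2 - S\<^sup>2"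
        using sin_cos_squared_add[of t] by algebra
      have Y: "recip_dist m c (2 * n) = p / r * (S' / sin t)" "recip_dist m c (2 * n + 1) = S / sin t"
        unfolding form S_def S'_def by (simp_all add: add.commute)
      have \<mu>c: "\<mu> * c = p / r * cos t" using pr(1,2) unfolding pr(5) c by (simp add: power2_eq_square)
      have "?L = (p / r * (S' / sin t))\<^sup>2 - 2 * (\<mu> * c) * (p / r * (S' / sin t)) * (S / sin t)"
        unfolding Y by (simp add: mult.assoc)
      also have "\<dots> = (p / r)\<^sup>2 * (S'\<^sup>2 - 2 * cos t * S' * S) / (sin t)\<^sup>2"
        unfolding \<mu>c by (simp add: power2_eq_square algebra_simps diff_divide_distrib)
      also have "\<dots> = \<mu> / \<nu> * ((sin t)\<^sup>2 - S\<^sup>2) / (sin t)\<^sup>2"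
        unfolding id pr(5,6) by (simp add: power_divide)
      finally have L: "?L = \<mu> / \<nu> * ((sin t)\<^sup>2 - S\<^sup>2) / (sin t)\<^sup>2" .
      have A: "?A = (1 - 2 * \<mu>) * S\<^sup>2 / (sin t)\<^sup>2"
        unfolding Y by (simp add: power_divide)
      have "?L = ?A \<longleftrightarrow> \<mu> / \<nu> * ((sin t)\<^sup>2 - S\<^sup>2) = (1 - 2 * \<mu>) * S\<^sup>2"
        unfolding L A divide_cancel_right using st by simp
      also have "\<dots> \<longleftrightarrow> \<mu> * ((sin t)\<^sup>2 - S\<^sup>2) = \<nu> * (1 - 2 * \<mu>) * S\<^sup>2"
        using mu by (simp add: field_simps)
      also have "\<dots> \<longleftrightarrow> \<mu> * (sin t)\<^sup>2 = (\<mu> + \<nu> - 2 * \<mu> * \<nu>) * S\<^sup>2"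
        by (auto simp: algebra_simps)
      also have "\<dots> \<longleftrightarrow> (\<mu> + \<nu> - 2 * \<mu> * \<nu>) * (K * sin t)\<^sup>2 = (\<mu> + \<nu> - 2 * \<mu> * \<nu>) * S\<^sup>2"
        by (subst K(2)[symmetric]) (simp add: power_mult_distrib mult_ac)
      also have "\<dots> \<longleftrightarrow> (K * sin t)\<^sup>2 = S\<^sup>2"
        using K mu by auto
      also have "\<dots> \<longleftrightarrow> S = K * sin t"
        using S0 K st by (auto simp: power2_eq_iff_nonneg)
      finally show ?thesis by (simp add: S_def)
    qed
    show ?thesis using P E by blast
  qed
  show ?thesis
  proof
    assume "capture_process m (capture_sequence n)"
    then obtain c where c: "\<bar>c\<bar> \<le> 1" and Y: "\<forall>i\<in>{1..2 * n + 1}. recip_dist m c i > 0" and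
      eq: "(recip_dist m c (2 * n))\<^sup>2 - 2 * \<mu> * c * recip_dist m c (2 * n) * recip_dist m c (2 * n + 1) =
      (1 - 2 * \<mu>) * (recip_dist m c (2 * n + 1))\<^sup>2"
      unfolding capture_process_iff_recip_dist[OF pos n] \<mu>_def by blast
    \<comment> \<open>The value is \<open>2 \<mu> c\<close>, so \<open>c\<close> is positive and
      \<open>t\<close> lies in the first quadrant.\<close>
    have "recip_dist m c 2 > 0" using bspec[OF Y, of 2] n by simp
    then have c0: "c > 0" using mu(1)
      by (simp add: numeral_2_eq_2 other_def \<mu>_def[symmetric] zero_less_mult_iff)
    have prs: "p * r > 0" using pr by simp
    then have le: "c * p * r \<le> cos \<phi>"
      using mult_right_mono[of c 1 "p * r"] c unfolding cos\<phi> by (simp add: mult.assoc)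
    then have le1: "c * p * r \<le> 1" using cos_le_one[of \<phi>] by linarith
    have ge0: "c * p * r > 0" using c0 pr by simp
    define t where "t = arccos (c * p * r)"
    have t: "cos t = c * p * r" "t \<le> pi / 2"
      using le1 ge0 arccos_le_pi2[of "c * p * r"] unfolding t_def by simp_all
    have "arccos (cos \<phi>) \<le> t"
      unfolding t_def using le ge0 by (intro arccos_le_arccos) auto
    then have "\<phi> \<le> t" using \<phi> by (simp add: arccos_cos)
    then show "\<exists>t\<ge>\<phi>. ?N * t < pi \<and> sin (?N * t) = K * sin t"
      using key[of t c] t \<phi> Y eq by auto
  next
    assume "\<exists>t\<ge>\<phi>. ?N * t < pi \<and> sin (?N * t) = K * sin t"
    then obtain t where t: "\<phi> \<le> t" "?N * t < pi" "sin (?N * t) = K * sin t" by blast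
    have "2 * t \<le> ?N * t" using n t \<phi> by (intro mult_right_mono) auto
    then have t2: "t < pi / 2" using t by linarith
    define c where "c = cos t / (p * r)"
    have c: "cos t = c * p * r" using pr by (simp add: c_def)
    have "cos t \<le> cos \<phi>" using t t2 \<phi> by (intro cos_monotone_0_pi_le) auto
    moreover have "cos t > 0" using t t2 \<phi> by (intro cos_gt_zero_pi) auto
    ultimately have "\<bar>c\<bar> \<le> 1" unfolding c_def using cos\<phi> pr by (simp add: abs_mult)
    then show "capture_process m (capture_sequence n)"
      unfolding capture_process_iff_recip_dist[OF pos n]
      using key[of t c] t t2 c \<phi> unfolding \<mu>_def by (intro exI[of _ c]) auto
  qed
qed

section \<open>From the equation for the turning angle to linear inequalities\<close>

text \<open>The quotient \<open>sin (N t) / sin t\<close> decreases strictly to \<open>0\<close> at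
  \<open>t = pi / N\<close>. It therefore takes the positive value \<open>K\<close> somewhere in
  \<open>\<phi> \<le> t < pi / N\<close> iff it is at least \<open>K\<close> at
  \<open>\<phi>\<close>.\<close>

lemma sin_multiple_root_iff:
  fixes N :: real
  assumes N: "N > 1" and \<phi>: "0 < \<phi>" and K: "K > 0"
  shows "(\<exists>t. \<phi> \<le> t \<and> N * t < pi \<and> sin (N * t) = K * sin t) \<longleftrightarrow>
    N * \<phi> < pi \<and> K * sin \<phi> \<le> sin (N * \<phi>)"
proof
  assume "\<exists>t. \<phi> \<le> t \<and> N * t < pi \<and> sin (N * t) = K * sin t"
  then obtain t where t: "\<phi> \<le> t" "N * t < pi" "sin (N * t) = K * sin t" by blast
  have "N * \<phi> \<le> N * t" using N t by simp
  then have less: "N * \<phi> < pi" using t by linarith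
  have sinpos: "sin s > 0" if "0 < s" "s \<le> t" for s
  proof (rule sin_gt_zero)
    have "s < N * s" using N that by simp
    also have "\<dots> \<le> N * t" using N that by simp
    finally show "s < pi" using t by linarith
  qed (use that in auto)
  show "N * \<phi> < pi \<and> K * sin \<phi> \<le> sin (N * \<phi>)"
  proof (cases "\<phi> = t")
    case False
    have "sin (N * t) / sin (1 * t) < sin (N * \<phi>) / sin (1 * \<phi>)"
      using False t N \<phi> by (intro sin_ratio_decreasing) auto
    then have "K < sin (N * \<phi>) / sin \<phi>"
      using t sinpos[of t] \<phi> by simp
    then show ?thesis using less sinpos[of \<phi>] \<phi> t by (simp add: field_simps)
  qed (use t in auto)
next
  assume R: "N * \<phi> < pi \<and> K * sin \<phi> \<le> sin (N * \<phi>)"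
  have le: "\<phi> \<le> pi / N" using R N by (simp add: field_simps)
  have end_neg: "sin (N * (pi / N)) - K * sin (pi / N) < 0"
    using N K by (simp add: sin_gt_zero field_simps)
  have "\<exists>t. \<phi> \<le> t \<and> t \<le> pi / N \<and> sin (N * t) - K * sin t = 0"
    using R end_neg by (intro IVT2' le continuous_intros) auto
  then obtain t where t: "\<phi> \<le> t" "t \<le> pi / N" "sin (N * t) - K * sin t = 0" by blast
  then have "t \<noteq> pi / N" using end_neg by auto
  then have "N * t < pi" using t N by (simp add: field_simps)
  then show "\<exists>t. \<phi> \<le> t \<and> N * t < pi \<and> sin (N * t) = K * sin t" using t by auto
qed

text \<open>The sine rises up to \<open>pi / 2\<close>, falls afterwards and is symmetric about
  \<open>pi / 2\<close>, so it is at least \<open>sin s\<close> exactly between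
  \<open>pi - s\<close> and \<open>s\<close>.\<close>

lemma sin_ge_sin_obtuse_iff:
  assumes s: "pi / 2 < s" "s < pi" and x: "0 < x"
  shows "x < pi \<and> sin s \<le> sin x \<longleftrightarrow> pi - s \<le> x \<and> x \<le> s"
proof -
  have 1: "sin s \<le> sin x \<longleftrightarrow> pi - s \<le> x" if "x \<le> pi / 2"
    using sin_mono_le_eq[of "pi - s" x] that s x by simp
  have 2: "sin s \<le> sin x \<longleftrightarrow> x \<le> s" if "pi / 2 < x" "x < pi"
    using sin_mono_le_eq[of "pi - s" "pi - x"] that s x by simp
  show ?thesis
  proof (cases "x \<le> pi / 2")
    case True
    then show ?thesis using 1 s by auto
  next
    case False
    then show ?thesis using 2 s by (cases "x < pi") auto
  qed
qed

section \<open>The boundary curves\<close>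

lemma cot_npi_diff: "cot (real n * pi - z) = - cot z"
  by (cases "even n") (simp_all add: cot_def sin_diff cos_diff)

lemma cot_npi_half_diff: "cot (real n * pi + pi / 2 - z) = tan z"
proof -
  have "cot (real n * pi - (z - pi / 2)) = - cot (z - pi / 2)" by (rule cot_npi_diff)
  then show ?thesis by (simp add: cot_def tan_def sin_diff cos_diff algebra_simps)
qed

lemma tan_half_pi_diff: "tan (pi / 2 - z) = 1 / tan (z::real)"
  by (simp add: tan_def sin_diff cos_diff)

text \<open>
  If \<open>\<eta>\<close>, \<open>\<chi>\<close>, \<open>\<psi>\<close> are the angles of an acute triangle, then
  \<open>- tan (\<eta> + \<chi>) = tan \<psi>\<close>, and the mass ratios with these angles are
  \<open>(tan \<eta> / tan \<chi>, tan \<psi> / tan \<chi>)\<close>.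
\<close>
lemma curve_point:
  assumes "0 < \<eta>" "\<eta> < pi / 2" "0 < \<chi>" "\<chi> < pi / 2" "pi / 2 < \<eta> + \<chi>"
  defines "x \<equiv> tan \<eta> / tan \<chi>"
  shows "x < (tan \<eta>)\<^sup>2" "- tan (\<eta> + \<chi>) / tan \<chi> = x * (1 + x) / ((tan \<eta>)\<^sup>2 - x)"
proof -
  have pos: "tan \<eta> > 0" "tan \<chi> > 0" using assms by (auto intro: tan_gt_zero)
  have c: "cos \<eta> > 0" "cos \<chi> > 0" using assms by (auto intro: cos_gt_zero_pi)
  \<comment> \<open>An angle sum above \<open>pi / 2\<close> means
    \<open>tan \<eta> tan \<chi> > 1\<close>, which fixes the sign of the denominator in the
    addition formula.\<close>
  have "tan (pi / 2 - \<chi>) < tan \<eta>" using assms by (intro tan_monotone) auto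
  then have gt: "tan \<eta> * tan \<chi> > 1"
    using pos unfolding tan_half_pi_diff by (simp add: field_simps)
  show "x < (tan \<eta>)\<^sup>2"
    using gt pos unfolding x_def by (simp add: field_simps power2_eq_square)
  have "sin (\<eta> + \<chi>) > 0" "cos (\<eta> + \<chi>) < 0"
    using assms cos_monotone_0_pi[of "pi / 2" "\<eta> + \<chi>"] by (auto intro!: sin_gt_zero)
  then have tan_sum: "tan (\<eta> + \<chi>) = (tan \<eta> + tan \<chi>) / (1 - tan \<eta> * tan \<chi>)"
    using c by (intro tan_add) auto
  define A B where "A = tan \<eta>" and "B = tan \<chi>"
  have AB: "A > 0" "B > 0" "A * B - 1 > 0" "1 - A * B \<noteq> 0" using pos gt by (auto simp: A_def B_def)
  have "- ((A + B) / (1 - A * B)) / B = (A + B) / ((A * B - 1) * B)"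
    using AB by (simp add: field_simps)
  also have "\<dots> = A / B * (1 + A / B) / (A\<^sup>2 - A / B)"
  proof -
    have "A\<^sup>2 - A / B = A * (A * B - 1) / B" using AB by (simp add: field_simps power2_eq_square)
    moreover have "A / B * (1 + A / B) = A * (A + B) / B\<^sup>2"
      using AB by (simp add: field_simps power2_eq_square)
    ultimately show ?thesis using AB by (simp add: power2_eq_square)
  qed
  finally show "- tan (\<eta> + \<chi>) / tan \<chi> = x * (1 + x) / ((tan \<eta>)\<^sup>2 - x)"
    unfolding tan_sum x_def A_def B_def .
qed

lemma curve_param:
  fixes n :: nat
  assumes "\<theta> = pi - 2 * \<eta>"
  shows "cot (\<theta> / 2) = tan \<eta>" "cot (real n * \<theta>) = - cot (2 * real n * \<eta>)"
    "cot ((real n + 1) * \<theta>) = - cot ((2 * real n + 2) * \<eta>)"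
    "cot ((real n + 1 / 2) * \<theta>) = tan ((2 * real n + 1) * \<eta>)"
proof -
  have "\<theta> / 2 = real 0 * pi + pi / 2 - \<eta>" by (simp add: assms)
  then show "cot (\<theta> / 2) = tan \<eta>" by (simp only: cot_npi_half_diff)
  have "real n * \<theta> = real n * pi - 2 * real n * \<eta>" by (simp add: assms algebra_simps)
  then show "cot (real n * \<theta>) = - cot (2 * real n * \<eta>)" by (simp only: cot_npi_diff)
  have "(real n + 1) * \<theta> = real (n + 1) * pi - (2 * real n + 2) * \<eta>"
    by (simp add: assms algebra_simps)
  then show "cot ((real n + 1) * \<theta>) = - cot ((2 * real n + 2) * \<eta>)" by (simp only: cot_npi_diff)
  have "(real n + 1 / 2) * \<theta> = real n * pi + pi / 2 - (2 * real n + 1) * \<eta>"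
    by (simp add: assms algebra_simps)
  then show "cot ((real n + 1 / 2) * \<theta>) = tan ((2 * real n + 1) * \<eta>)" by (simp only: cot_npi_half_diff)
qed

text \<open>Here the triangle has angles \<open>\<eta>\<close> and
  \<open>\<chi> = 2 n \<eta>\<close>, and the range of \<open>\<eta>\<close> says that
  \<open>\<chi> < pi / 2 < \<eta> + \<chi>\<close>. Eliminating \<open>\<chi>\<close> from
  \<open>y\<close> makes points with the same \<open>x\<close> comparable through
  \<open>\<eta>\<close> alone; \<open>x < (tan \<eta>)^2\<close> keeps the denominator
  positive.\<close>

lemma C_even_iff:
  assumes n: "n \<ge> 1"
  shows "(x, y) \<in> C_even n \<longleftrightarrow>
    (\<exists>\<eta>. pi / (4 * real n + 2) < \<eta> \<and> \<eta> < pi / (4 * real n) \<and> x < (tan \<eta>)\<^sup>2 \<and>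
      x = tan \<eta> / tan (2 * real n * \<eta>) \<and> y = x * (1 + x) / ((tan \<eta>)\<^sup>2 - x))"
proof -
  define P where "P \<eta> \<longleftrightarrow> pi / (4 * real n + 2) < \<eta> \<and> \<eta> < pi / (4 * real n)" for \<eta>
  have n1: "real n \<ge> 1" using n by simp
  have rng: "(2 * real n - 1) * pi / (2 * real n) < pi - 2 * \<eta> \<and>
      pi - 2 * \<eta> < 2 * real n * pi / (2 * real n + 1) \<longleftrightarrow> P \<eta>" for \<eta>
    unfolding P_def using n1 by (auto simp: field_simps)
  have pt: "- cot ((pi - 2 * \<eta>) / 2) * cot (real n * (pi - 2 * \<eta>)) = tan \<eta> / tan (2 * real n * \<eta>)"
    "cot ((real n + 1 / 2) * (pi - 2 * \<eta>)) * cot (real n * (pi - 2 * \<eta>)) =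
      - tan (\<eta> + 2 * real n * \<eta>) / tan (2 * real n * \<eta>)" for \<eta>
    unfolding curve_param[OF refl] by (simp_all add: cot_altdef algebra_simps divide_inverse)
  have "(x, y) \<in> C_even n \<longleftrightarrow>
    (\<exists>\<eta>. P \<eta> \<and> x = tan \<eta> / tan (2 * real n * \<eta>) \<and> y = - tan (\<eta> + 2 * real n * \<eta>) / tan (2 * real n * \<eta>))"
    (is "?L \<longleftrightarrow> ?R")
  proof
    assume ?L
    then obtain \<theta> where h: "(2 * real n - 1) * pi / (2 * real n) < \<theta> \<and> \<theta> < 2 * real n * pi / (2 * real n + 1)"
      "x = - cot (\<theta> / 2) * cot (real n * \<theta>)" "y = cot ((real n + 1/2) * \<theta>) * cot (real n * \<theta>)"
      unfolding C_even_def by blast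
    have "\<theta> = pi - 2 * ((pi - \<theta>) / 2)" by (simp add: field_simps)
    then show ?R using h rng[of "(pi - \<theta>) / 2"] pt[of "(pi - \<theta>) / 2"] by metis
  next
    assume ?R
    then obtain \<eta> where h: "P \<eta>" "x = tan \<eta> / tan (2 * real n * \<eta>)"
      "y = - tan (\<eta> + 2 * real n * \<eta>) / tan (2 * real n * \<eta>)" by blast
    show ?L unfolding C_even_def
      by (intro CollectI exI[of _ "pi - 2 * \<eta>"]) (metis h rng pt)
  qed
  moreover have "x < (tan \<eta>)\<^sup>2 \<and> - tan (\<eta> + 2 * real n * \<eta>) / tan (2 * real n * \<eta>) = x * (1 + x) / ((tan \<eta>)\<^sup>2 - x)"
    if h: "P \<eta>" "x = tan \<eta> / tan (2 * real n * \<eta>)" for \<eta>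
  proof -
    have b: "pi < (4 * real n + 2) * \<eta>" "4 * real n * \<eta> < pi"
      using h(1) n1 unfolding P_def by (auto simp: field_simps)
    have pos: "0 < \<eta>" using h(1) n1 pi_gt_zero unfolding P_def by (smt (verit) divide_pos_pos)
    have "2 * \<eta> \<le> 4 * real n * \<eta>" using pos n1 by simp
    then have "\<eta> < pi / 2" using b by linarith
    moreover have "0 < 2 * real n * \<eta>" using pos n1 by simp
    moreover have "2 * real n * \<eta> < pi / 2" "pi / 2 < \<eta> + 2 * real n * \<eta>"
      using b by (auto simp: algebra_simps)
    ultimately show ?thesis using curve_point[OF pos, of "2 * real n * \<eta>"] h(2) by blast
  qed
  ultimately show ?thesis unfolding P_def by metis
qed

text \<open>The same elimination with \<open>\<chi> = pi - (2 n + 2) \<eta>\<close>, called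
  \<open>X \<eta>\<close> below; again the range of \<open>\<eta>\<close> says that
  \<open>\<chi> < pi / 2 < \<eta> + \<chi>\<close>.\<close>

lemma C_odd_iff:
  "(x, y) \<in> C_odd n \<longleftrightarrow>
    (\<exists>\<eta>. pi / (4 * real n + 4) < \<eta> \<and> \<eta> < pi / (4 * real n + 2) \<and> x < (tan \<eta>)\<^sup>2 \<and>
      x = - tan \<eta> / tan ((2 * real n + 2) * \<eta>) \<and> y = x * (1 + x) / ((tan \<eta>)\<^sup>2 - x))"
proof -
  define P where "P \<eta> \<longleftrightarrow> pi / (4 * real n + 4) < \<eta> \<and> \<eta> < pi / (4 * real n + 2)" for \<eta>
  define X where "X \<eta> = pi - (2 * real n + 2) * \<eta>" for \<eta>
  have tX: "tan (X \<eta>) = - tan ((2 * real n + 2) * \<eta>)" for \<eta>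
    unfolding X_def by (simp add: tan_def sin_diff cos_diff)
  have tX1: "tan (\<eta> + X \<eta>) = - tan ((2 * real n + 1) * \<eta>)" for \<eta>
  proof -
    have "\<eta> + X \<eta> = pi - (2 * real n + 1) * \<eta>" by (simp add: X_def algebra_simps)
    then show ?thesis by (simp add: tan_def sin_diff cos_diff)
  qed
  have rng: "2 * real n * pi / (2 * real n + 1) < pi - 2 * \<eta> \<and>
      pi - 2 * \<eta> < (2 * real n + 1) * pi / (2 * real n + 2) \<longleftrightarrow> P \<eta>" for \<eta>
  proof -
    have "2 * real n * pi / (2 * real n + 1) < pi - 2 * \<eta> \<longleftrightarrow> \<eta> < pi / (4 * real n + 2)"
      by (simp add: field_simps)
    moreover have "pi - 2 * \<eta> < (2 * real n + 1) * pi / (2 * real n + 2) \<longleftrightarrow> pi / (4 * real n + 4) < \<eta>"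
      by (simp add: field_simps)
    ultimately show ?thesis unfolding P_def by blast
  qed
  have pt: "cot ((pi - 2 * \<eta>) / 2) * cot ((real n + 1) * (pi - 2 * \<eta>)) = tan \<eta> / tan (X \<eta>)"
    "cot ((real n + 1 / 2) * (pi - 2 * \<eta>)) * cot ((real n + 1) * (pi - 2 * \<eta>)) =
      - tan (\<eta> + X \<eta>) / tan (X \<eta>)" for \<eta>
    unfolding curve_param[OF refl] tX tX1 by (simp_all add: cot_altdef divide_inverse)
  have "(x, y) \<in> C_odd n \<longleftrightarrow>
    (\<exists>\<eta>. P \<eta> \<and> x = tan \<eta> / tan (X \<eta>) \<and> y = - tan (\<eta> + X \<eta>) / tan (X \<eta>))"
    (is "?L \<longleftrightarrow> ?R")
  proof
    assume ?L
    then obtain \<theta> where h: "2 * real n * pi / (2 * real n + 1) < \<theta> \<and>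
        \<theta> < (2 * real n + 1) * pi / (2 * real n + 2)"
      "x = cot (\<theta> / 2) * cot ((real n + 1) * \<theta>)" "y = cot ((real n + 1/2) * \<theta>) * cot ((real n + 1) * \<theta>)"
      unfolding C_odd_def by blast
    have "\<theta> = pi - 2 * ((pi - \<theta>) / 2)" by (simp add: field_simps)
    then show ?R using h rng[of "(pi - \<theta>) / 2"] pt[of "(pi - \<theta>) / 2"] by metis
  next
    assume ?R
    then obtain \<eta> where h: "P \<eta>" "x = tan \<eta> / tan (X \<eta>)" "y = - tan (\<eta> + X \<eta>) / tan (X \<eta>)"
      by blast
    show ?L unfolding C_odd_def
      by (intro CollectI exI[of _ "pi - 2 * \<eta>"]) (metis h rng pt)
  qed
  moreover have "x < (tan \<eta>)\<^sup>2 \<and> - tan (\<eta> + X \<eta>) / tan (X \<eta>) = x * (1 + x) / ((tan \<eta>)\<^sup>2 - x)"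
    if h: "P \<eta>" "x = tan \<eta> / tan (X \<eta>)" for \<eta>
  proof -
    have b: "pi < (4 * real n + 4) * \<eta>" "(4 * real n + 2) * \<eta> < pi"
      using h(1) unfolding P_def by (auto simp: field_simps)
    have pos: "0 < \<eta>" using h(1) pi_gt_zero unfolding P_def by (smt (verit) divide_pos_pos of_nat_0_le_iff)
    have n\<eta>: "real n * \<eta> \<ge> 0" using pos by simp
    have e: "(4 * real n + 4) * \<eta> = 4 * (real n * \<eta>) + 4 * \<eta>"
      "(4 * real n + 2) * \<eta> = 4 * (real n * \<eta>) + 2 * \<eta>"
      "X \<eta> = pi - 2 * (real n * \<eta>) - 2 * \<eta>"
      by (simp_all add: X_def algebra_simps)
    have "\<eta> < pi / 2" "0 < X \<eta>" "X \<eta> < pi / 2" "pi / 2 < \<eta> + X \<eta>"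
      using b pos n\<eta> unfolding e by linarith+
    then show ?thesis using curve_point[OF pos, of "X \<eta>"] h(2) by blast
  qed
  ultimately have "(x, y) \<in> C_odd n \<longleftrightarrow>
    (\<exists>\<eta>. P \<eta> \<and> x < (tan \<eta>)\<^sup>2 \<and> x = tan \<eta> / tan (X \<eta>) \<and> y = x * (1 + x) / ((tan \<eta>)\<^sup>2 - x))"
    by metis
  then show ?thesis unfolding P_def tX by (simp add: conj_ac)
qed

section \<open>Comparison of the angle of a mass point with the angles on the curves\<close>

text \<open>Since \<open>a = tan \<phi> / tan \<chi>\<close>, the inequality
  \<open>N \<phi> \<le> \<chi>\<close> says that the decreasing function
  \<open>tan t / tan (N t)\<close> is at least \<open>a\<close> at \<open>\<phi>\<close>. It tends
  to \<open>0\<close> at \<open>pi / (2 N)\<close>, so it takes the value \<open>a\<close> at some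
  \<open>\<eta> \<ge> \<phi>\<close>.\<close>

lemma lower_boundary:
  fixes N :: real
  assumes N: "N \<ge> 2" and \<phi>: "0 < \<phi>" "\<phi> < pi / 2" and \<chi>: "0 < \<chi>" "\<chi> < pi / 2" "pi / 2 < \<phi> + \<chi>"
    and a: "tan \<phi> = a * tan \<chi>"
  shows "N * \<phi> \<le> \<chi> \<longleftrightarrow>
    (\<exists>\<eta>. pi / (2 * N + 2) < \<eta> \<and> \<eta> < pi / (2 * N) \<and> \<phi> \<le> \<eta> \<and> a = tan \<eta> / tan (N * \<eta>))"
proof -
  have tp: "tan \<phi> > 0" "tan \<chi> > 0" using \<phi> \<chi> by (auto intro: tan_gt_zero)
  have a_eq: "a = tan \<phi> / tan \<chi>" using a tp by simp
  have a0: "a > 0" using a_eq tp by simp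
  have agt: "a < (tan \<phi>)\<^sup>2" using curve_point(1)[OF \<phi> \<chi>] a_eq by simp
  show ?thesis
  proof
    assume L: "N * \<phi> \<le> \<chi>"
    have p0: "0 < N * \<phi>" "N * \<phi> < pi / 2" using N \<phi> L \<chi> by auto
    have le: "\<phi> \<le> pi / (2 * N)" using p0 N by (simp add: field_simps)
    have h2: "0 < pi / (2 * N)" "pi / (2 * N) < pi / 2" using N by (auto simp: field_simps)
    \<comment> \<open>This is \<open>tan t / tan (N t) - a\<close> multiplied by
      \<open>cos t sin (N t)\<close>, so that the intermediate value theorem applies up to
      \<open>t = pi / (2 N)\<close>.\<close>
    define F where "F t = sin t * cos (N * t) - a * cos t * sin (N * t)" for t
    have Fend: "F (pi / (2 * N)) < 0"
    proof -
      have "N * (pi / (2 * N)) = pi / 2" using N by simp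
      then have "F (pi / (2 * N)) = - (a * cos (pi / (2 * N)))"
        unfolding F_def by (simp only: cos_pi_half sin_pi_half)
      moreover have "cos (pi / (2 * N)) > 0" using h2 by (intro cos_gt_zero_pi) auto
      ultimately show ?thesis using a0 by simp
    qed
    have Fstart: "0 \<le> F \<phi>"
    proof -
      have "tan (N * \<phi>) \<le> tan \<chi>" using p0 L \<chi> by (intro tan_mono_le) auto
      then have "a * tan (N * \<phi>) \<le> tan \<phi>" using a a0 by simp
      moreover have "cos \<phi> > 0" "cos (N * \<phi>) > 0" using \<phi> p0 by (auto intro: cos_gt_zero_pi)
      ultimately show ?thesis unfolding F_def tan_def by (simp add: field_simps)
    qed
    have "\<exists>t. \<phi> \<le> t \<and> t \<le> pi / (2 * N) \<and> F t = 0"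
      using Fstart Fend le unfolding F_def by (intro IVT2' continuous_intros) auto
    then obtain \<eta> where \<eta>: "\<phi> \<le> \<eta>" "\<eta> \<le> pi / (2 * N)" "F \<eta> = 0" by blast
    then have "\<eta> \<noteq> pi / (2 * N)" using Fend by auto
    then have lt: "\<eta> < pi / (2 * N)" using \<eta> by simp
    have N\<eta>: "0 < N * \<eta>" "N * \<eta> < pi / 2" using lt N \<eta> \<phi> by (auto simp: field_simps)
    have \<eta>2: "\<eta> < pi / 2" using lt h2 by linarith
    have c: "cos \<eta> > 0" "cos (N * \<eta>) > 0" "sin (N * \<eta>) > 0"
      using \<eta>2 N\<eta> \<eta> \<phi> by (auto intro: cos_gt_zero_pi sin_gt_zero)
    have a\<eta>: "a = tan \<eta> / tan (N * \<eta>)"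
      using \<eta>(3) c unfolding F_def tan_def by (simp add: field_simps)
    have tpos: "tan \<eta> > 0" "tan (N * \<eta>) > 0" using \<eta> \<phi> \<eta>2 N\<eta> by (auto intro!: tan_gt_zero)
    have "tan \<phi> \<le> tan \<eta>" using \<phi> \<eta> \<eta>2 by (intro tan_mono_le) auto
    then have "(tan \<phi>)\<^sup>2 \<le> (tan \<eta>)\<^sup>2" using tp by (intro power_mono) auto
    \<comment> \<open>The bound \<open>a < (tan \<eta>)^2\<close> now gives
      \<open>\<eta> + N \<eta> > pi / 2\<close>, the lower end of the parameter range.\<close>
    then have "tan \<eta> / tan (N * \<eta>) < (tan \<eta>)\<^sup>2" using agt a\<eta> by simp
    then have "1 / tan \<eta> < tan (N * \<eta>)" using tpos by (simp add: field_simps power2_eq_square)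
    then have "tan (pi / 2 - \<eta>) < tan (N * \<eta>)" by (simp only: tan_half_pi_diff)
    then have "pi / 2 - \<eta> < N * \<eta>"
      using tan_mono_le[of "N * \<eta>" "pi / 2 - \<eta>"] N\<eta> \<eta> \<phi> by (smt (verit))
    then have "pi / (2 * N + 2) < \<eta>" using N by (simp add: field_simps)
    then show "\<exists>\<eta>. pi / (2 * N + 2) < \<eta> \<and> \<eta> < pi / (2 * N) \<and> \<phi> \<le> \<eta> \<and> a = tan \<eta> / tan (N * \<eta>)"
      using lt \<eta> a\<eta> by blast
  next
    assume "\<exists>\<eta>. pi / (2 * N + 2) < \<eta> \<and> \<eta> < pi / (2 * N) \<and> \<phi> \<le> \<eta> \<and> a = tan \<eta> / tan (N * \<eta>)"
    then obtain \<eta> where \<eta>: "\<eta> < pi / (2 * N)" "\<phi> \<le> \<eta>" "a = tan \<eta> / tan (N * \<eta>)" by blast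
    have N\<eta>: "N * \<eta> < pi / 2" using \<eta> N by (simp add: field_simps)
    have "N * \<phi> \<le> N * \<eta>" using \<eta> N by simp
    then have p0: "0 < N * \<phi>" "N * \<phi> < pi / 2" using N\<eta> N \<phi> by (simp, linarith)
    have "\<eta> \<le> N * \<eta>" using N \<eta> \<phi> by simp
    then have bd: "(N + 1) * \<eta> \<le> pi" using N\<eta> by (simp add: algebra_simps)
    have "a \<le> tan \<phi> / tan (N * \<phi>)"
    proof (cases "\<phi> = \<eta>")
      case False
      then show ?thesis
        using tan_cot_decreasing[of N \<phi> \<eta>] N \<phi> \<eta> bd by simp
    qed (use \<eta> in auto)
    moreover have "tan (N * \<phi>) > 0" using p0 by (intro tan_gt_zero)
    ultimately have "a * tan (N * \<phi>) \<le> a * tan \<chi>" using a by (simp add: field_simps)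
    then have "tan (N * \<phi>) \<le> tan \<chi>" using a0 by simp
    then show "N * \<phi> \<le> \<chi>"
      using tan_monotone[of \<chi> "N * \<phi>"] p0 \<chi> by (smt (verit))
  qed
qed

text \<open>The negation is proved: \<open>N \<phi> < pi - \<chi>\<close> iff some
  \<open>\<eta> > \<phi>\<close> in the range gives the value \<open>a\<close>. The argument is that
  of \<open>lower_boundary\<close> on the branch where \<open>N \<eta>\<close> is obtuse. If there
  is no \<open>\<eta>\<close> with value \<open>a\<close>, the right side holds vacuously.\<close>

lemma upper_boundary:
  fixes N :: real
  assumes N: "N \<ge> 3" and \<phi>: "0 < \<phi>" "\<phi> < pi / 2" and \<chi>: "0 < \<chi>" "\<chi> < pi / 2" "pi / 2 < \<phi> + \<chi>"
    and a: "tan \<phi> = a * tan \<chi>"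
  shows "pi - \<chi> \<le> N * \<phi> \<longleftrightarrow>
    (\<forall>\<eta>. pi / (2 * N) < \<eta> \<and> \<eta> < pi / (2 * N - 2) \<and> a = - tan \<eta> / tan (N * \<eta>) \<longrightarrow> \<eta> \<le> \<phi>)"
proof -
  have tp: "tan \<phi> > 0" "tan \<chi> > 0" using \<phi> \<chi> by (auto intro: tan_gt_zero)
  have a_eq: "a = tan \<phi> / tan \<chi>" using a tp by simp
  have a0: "a > 0" using a_eq tp by simp
  have agt: "a < (tan \<phi>)\<^sup>2" using curve_point(1)[OF \<phi> \<chi>] a_eq by simp
  have tz: "tan (pi - N * t) = - tan (N * t)" for t
    by (simp add: tan_def sin_diff cos_diff)
  have "N * \<phi> < pi - \<chi> \<longleftrightarrow>
    (\<exists>\<eta>. pi / (2 * N) < \<eta> \<and> \<eta> < pi / (2 * N - 2) \<and> a = - tan \<eta> / tan (N * \<eta>) \<and> \<phi> < \<eta>)"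
  proof
    assume "\<exists>\<eta>. pi / (2 * N) < \<eta> \<and> \<eta> < pi / (2 * N - 2) \<and> a = - tan \<eta> / tan (N * \<eta>) \<and> \<phi> < \<eta>"
    then obtain \<eta> where \<eta>: "\<eta> < pi / (2 * N - 2)" "a = - tan \<eta> / tan (N * \<eta>)" "\<phi> < \<eta>" by blast
    show "N * \<phi> < pi - \<chi>"
    proof (cases "N * \<phi> \<le> pi / 2")
      case False
      have N\<eta>: "(2 * N - 2) * \<eta> < pi" using \<eta> N by (simp add: field_simps)
      have "N * \<eta> \<ge> 3 * \<eta>" using N \<eta> \<phi> by (intro mult_right_mono) auto
      then have bd: "(N + 1) * \<eta> \<le> pi" using N\<eta> by (simp add: algebra_simps)
      then have "N * \<eta> < pi" using \<eta> \<phi> by (simp add: algebra_simps)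
      moreover have "N * \<phi> < N * \<eta>" using \<eta> N by simp
      ultimately have z: "0 < pi - N * \<phi>" "pi - N * \<phi> < pi / 2" using False by auto
      have "- a < tan \<phi> / tan (N * \<phi>)"
        using tan_cot_decreasing[of N \<phi> \<eta>] N \<phi> \<eta> bd by simp
      then have "tan \<phi> / tan (pi - N * \<phi>) < a" unfolding tz by simp
      moreover have "tan (pi - N * \<phi>) > 0" using z by (intro tan_gt_zero)
      ultimately have "a * tan \<chi> < a * tan (pi - N * \<phi>)" using a by (simp add: field_simps)
      then have "tan \<chi> < tan (pi - N * \<phi>)" using a0 by simp
      then show ?thesis
        using tan_mono_le[of "pi - N * \<phi>" \<chi>] z \<chi> by (smt (verit))
    qed (use \<chi> in auto)
  next
    assume L: "N * \<phi> < pi - \<chi>"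
    define R where "R = pi / (2 * N - 2)"
    \<comment> \<open>Hence \<open>F R = a (cos R)^2 - (sin R)^2\<close>, which is negative because
      \<open>a < (tan \<phi>)^2 < (tan R)^2\<close>.\<close>
    have NR: "N * R = pi / 2 + R" using N by (simp add: R_def field_simps)
    have "(2 * N - 2) * \<phi> < pi" using L \<chi> by (simp add: algebra_simps)
    then have \<phi>R: "\<phi> < R" using N by (simp add: R_def field_simps)
    have R2: "0 < R" "R < pi / 2" using N by (auto simp: R_def field_simps)
    define F where "F t = sin t * cos (N * t) + a * cos t * sin (N * t)" for t
    have Fend: "F R < 0"
    proof -
      have "tan \<phi> < tan R" using \<phi> \<phi>R R2 by (intro tan_monotone) auto
      then have "(tan \<phi>)\<^sup>2 < (tan R)\<^sup>2" using tp by (intro power_strict_mono) auto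
      then have "a < (tan R)\<^sup>2" using agt by linarith
      moreover have "cos R > 0" using R2 by (intro cos_gt_zero_pi) auto
      ultimately have "a * (cos R)\<^sup>2 < (sin R)\<^sup>2" by (simp add: tan_def field_simps)
      then show ?thesis unfolding F_def NR by (simp add: cos_add sin_add power2_eq_square)
    qed
    \<comment> \<open>Starting at the maximum makes the root exceed both \<open>\<phi>\<close> and
      the lower end of the parameter range.\<close>
    define M where "M = max \<phi> (pi / (2 * N))"
    have M0: "0 < M" "M < R" using \<phi> \<phi>R N by (auto simp: M_def R_def field_simps)
    have Fstart: "F M > 0"
    proof (cases "N * \<phi> \<le> pi / 2")
      case True
      then have "\<phi> \<le> pi / (2 * N)" using N by (simp add: field_simps)
      then have M: "M = pi / (2 * N)" by (simp add: M_def)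
      have NM: "N * M = pi / 2" using N by (simp add: M)
      have "cos M > 0" using M0 R2 by (intro cos_gt_zero_pi) auto
      then show ?thesis unfolding F_def NM using a0 by simp
    next
      case False
      then have "\<phi> > pi / (2 * N)" using N by (simp add: field_simps)
      then have M: "M = \<phi>" by (simp add: M_def)
      define z where "z = pi - N * \<phi>"
      have z: "0 < z" "z < pi / 2" "\<chi> < z" using False L \<chi> by (auto simp: z_def)
      have "tan \<chi> < tan z" using z \<chi> by (intro tan_monotone) auto
      then have "tan \<phi> < a * tan z" using a a0 by simp
      moreover have "cos \<phi> > 0" "cos z > 0" using \<phi> z by (auto intro: cos_gt_zero_pi)
      ultimately have "sin \<phi> * cos z < a * cos \<phi> * sin z" by (simp add: tan_def field_simps)
      moreover have "cos (N * \<phi>) = - cos z" "sin (N * \<phi>) = sin z" by (simp_all add: z_def)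
      ultimately show ?thesis unfolding F_def M by simp
    qed
    have "\<exists>t. M \<le> t \<and> t \<le> R \<and> F t = 0"
      using Fstart Fend M0 unfolding F_def by (intro IVT2' continuous_intros) auto
    then obtain \<eta> where \<eta>: "M \<le> \<eta>" "\<eta> \<le> R" "F \<eta> = 0" by blast
    then have "\<eta> \<noteq> M" "\<eta> \<noteq> R" using Fstart Fend by auto
    then have lt: "M < \<eta>" "\<eta> < R" using \<eta> by auto
    have "N * \<eta> < N * R" using lt N by simp
    then have N\<eta>: "0 < N * \<eta>" "N * \<eta> < pi" using NR R2 lt M0 N by auto
    have c: "cos \<eta> > 0" "sin (N * \<eta>) > 0"
      using N\<eta> lt M0 R2 by (auto intro: cos_gt_zero_pi sin_gt_zero)
    have "a = - (sin \<eta> * cos (N * \<eta>)) / (cos \<eta> * sin (N * \<eta>))"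
      using \<eta>(3) c unfolding F_def by (simp add: field_simps)
    then have "a = - tan \<eta> / tan (N * \<eta>)" by (simp add: tan_def)
    then show "\<exists>\<eta>. pi / (2 * N) < \<eta> \<and> \<eta> < pi / (2 * N - 2) \<and> a = - tan \<eta> / tan (N * \<eta>) \<and> \<phi> < \<eta>"
      using lt unfolding M_def R_def by auto
  qed
  then have "\<not> N * \<phi> < pi - \<chi> \<longleftrightarrow>
    (\<forall>\<eta>. pi / (2 * N) < \<eta> \<and> \<eta> < pi / (2 * N - 2) \<and> a = - tan \<eta> / tan (N * \<eta>) \<longrightarrow> \<not> \<phi> < \<eta>)"
    by blast
  then show ?thesis by (simp only: not_less)
qed

section \<open>The acute triangle belonging to given mass ratios\<close>

lemma cos_squared_eq_tan: "cos x \<noteq> 0 \<Longrightarrow> (cos x)\<^sup>2 = 1 / (1 + (tan x)\<^sup>2)" for x :: real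
  by (simp add: tan_sec inverse_eq_divide power_divide)

lemma mass_angles_exist:
  fixes a b :: real
  assumes ab: "a > 0" "b > 0"
  obtains \<phi> \<chi> K where "0 < \<phi>" "\<phi> < pi / 2" "0 < \<chi>" "\<chi> < pi / 2" "pi / 2 < \<phi> + \<chi>"
    "tan \<phi> = a * tan \<chi>" "b = a * (1 + a) / ((tan \<phi>)\<^sup>2 - a)"
    "(cos \<phi>)\<^sup>2 = b / ((1 + a) * (a + b))"
    "K > 0" "K\<^sup>2 = b * (1 + a) / (a * (1 + b))" "sin (\<phi> + \<chi>) = K * sin \<phi>"
proof
  \<comment> \<open>The third angle is to have tangent \<open>b T\<close>. In a triangle the sum of
    the tangents equals their product, so \<open>(1 + a + b) T = a b T^3\<close>.\<close>
  define T where "T = sqrt ((1 + a + b) / (a * b))"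
  have T: "T > 0" "T\<^sup>2 = (1 + a + b) / (a * b)" using ab by (simp_all add: T_def)
  define \<phi> \<chi> where "\<phi> = arctan (a * T)" and "\<chi> = arctan T"
  \<comment> \<open>The sine of the third angle over the sine of \<open>\<phi>\<close>; its square
    turns out to be the constant of \<open>capture_process_iff_angle\<close>.\<close>
  define K where "K = sin (\<phi> + \<chi>) / sin \<phi>"
  show \<phi>: "0 < \<phi>" "\<phi> < pi / 2" and \<chi>: "0 < \<chi>" "\<chi> < pi / 2"
    using T ab arctan_ubound[of "a * T"] arctan_ubound[of T] by (auto simp: \<phi>_def \<chi>_def)
  have tan: "tan \<phi> = a * T" "tan \<chi> = T" unfolding \<phi>_def \<chi>_def by (rule tan_arctan)+
  then show "tan \<phi> = a * tan \<chi>" by simp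
  have c: "cos \<phi> > 0" "cos \<chi> > 0" using \<phi> \<chi> by (auto intro: cos_gt_zero_pi)
  have s: "sin \<phi> = a * T * cos \<phi>" "sin \<chi> = T * cos \<chi>"
    using tan c by (simp_all add: tan_def field_simps)
  have s0: "sin \<phi> > 0" using \<phi> by (intro sin_gt_zero) auto
  have "a * T\<^sup>2 > 1" using ab unfolding T(2) by (simp add: field_simps add_pos_pos)
  moreover have "cos (\<phi> + \<chi>) = cos \<phi> * cos \<chi> * (1 - a * T\<^sup>2)"
    unfolding cos_add s by (simp add: power2_eq_square algebra_simps)
  ultimately have "cos (\<phi> + \<chi>) < 0" using c by (simp add: mult_less_0_iff)
  then show "pi / 2 < \<phi> + \<chi>" using \<phi> \<chi> cos_ge_zero[of "\<phi> + \<chi>"] by (smt (verit))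
  have tan2: "(tan \<phi>)\<^sup>2 = a * (1 + a + b) / b"
    using ab unfolding tan power_mult_distrib T(2) by (simp add: power2_eq_square)
  then have "(tan \<phi>)\<^sup>2 - a = a * (1 + a) / b" using ab by (simp add: field_simps)
  then show "b = a * (1 + a) / ((tan \<phi>)\<^sup>2 - a)" using ab by simp
  have "(cos \<phi>)\<^sup>2 = 1 / (1 + (tan \<phi>)\<^sup>2)"
    using c by (intro cos_squared_eq_tan) simp
  also have "\<dots> = b / ((1 + a) * (a + b))"
  proof -
    have "1 + (tan \<phi>)\<^sup>2 = (1 + a) * (a + b) / b" unfolding tan2 using ab by (simp add: field_simps)
    then show ?thesis by simp
  qed
  finally show "(cos \<phi>)\<^sup>2 = b / ((1 + a) * (a + b))" .
  show "sin (\<phi> + \<chi>) = K * sin \<phi>" using s0 by (simp add: K_def)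
  have "sin (\<phi> + \<chi>) > 0" using \<phi> \<chi> by (intro sin_gt_zero) auto
  then show "K > 0" using s0 by (simp add: K_def)
  have "K = (1 + a) / a * cos \<chi>"
    using c ab T unfolding K_def sin_add s by (simp add: field_simps)
  then have "K\<^sup>2 = ((1 + a) / a)\<^sup>2 * (cos \<chi>)\<^sup>2" by (simp only: power_mult_distrib)
  also have "(cos \<chi>)\<^sup>2 = 1 / (1 + (tan \<chi>)\<^sup>2)"
    using c by (intro cos_squared_eq_tan) simp
  also have "1 + (tan \<chi>)\<^sup>2 = (1 + a) * (1 + b) / (a * b)"
    unfolding tan T(2) using ab by (simp add: field_simps)
  also have "((1 + a) / a)\<^sup>2 * (1 / ((1 + a) * (1 + b) / (a * b))) = b * (1 + a) / (a * (1 + b))"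
    using ab by (simp add: power2_eq_square divide_simps)
  finally show "K\<^sup>2 = b * (1 + a) / (a * (1 + b))" .
qed

theorem mainTheorem2:
  fixes m :: "particle \<Rightarrow> real" and a b :: real and n :: nat
  assumes "\<And>i. m i > 0"
    and "a = m P1 / m P2" and "b = m P3 / m P2"
    and "n \<ge> 1"
  shows "capture_process m (capture_sequence n) \<longleftrightarrow>
    (\<exists>b'. (a, b') \<in> C_even n \<and> b' \<le> b) \<and> (\<forall>b''. (a, b'') \<in> C_odd n \<longrightarrow> b \<le> b'')"
proof -
  have ab: "a > 0" "b > 0" using assms(1-3) by simp_all
  have n1: "real n \<ge> 1" using assms(4) by simp
  obtain \<phi> \<chi> K where \<phi>: "0 < \<phi>" "\<phi> < pi / 2" and \<chi>: "0 < \<chi>" "\<chi> < pi / 2" "pi / 2 < \<phi> + \<chi>"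
    and a: "tan \<phi> = a * tan \<chi>" and b: "b = a * (1 + a) / ((tan \<phi>)\<^sup>2 - a)"
    and cos\<phi>: "(cos \<phi>)\<^sup>2 = b / ((1 + a) * (a + b))"
    and K: "K > 0" "K\<^sup>2 = b * (1 + a) / (a * (1 + b))" "sin (\<phi> + \<chi>) = K * sin \<phi>"
    using mass_angles_exist[OF ab] by metis
  have \<mu>: "mass_frac m P3 = b / (a + b)" and \<nu>: "mass_frac m P2 = 1 / (1 + a)"
    using assms(1)[of P1] assms(1)[of P2] assms(1)[of P3]
    by (simp_all add: assms(2,3) mass_frac_def field_simps)
  have K': "K\<^sup>2 * (b / (a + b) + 1 / (1 + a) - 2 * (b / (a + b)) * (1 / (1 + a))) = b / (a + b)"
  proof -
    have "b / (a + b) + 1 / (1 + a) - 2 * (b / (a + b)) * (1 / (1 + a)) = a * (1 + b) / ((a + b) * (1 + a))"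
      using ab by (simp add: divide_simps) (simp add: algebra_simps)
    then show ?thesis unfolding K(2) using ab by simp
  qed
  have t\<phi>: "a < (tan \<phi>)\<^sup>2"
    using curve_point(1)[OF \<phi> \<chi>] a tan_gt_zero[OF \<chi>(1,2)] by simp
  have inv_le: "k / u \<le> k / w \<longleftrightarrow> w \<le> u" if "k > 0" "u > 0" "w > 0" for k u w :: real
    using that by (simp add: field_simps)
  \<comment> \<open>For fixed \<open>a\<close> the height on the curves decreases in the angle, and
    \<open>b\<close> is the height at \<open>\<phi>\<close>. Comparing \<open>b\<close> with a point
    of a curve thus amounts to comparing \<open>\<phi>\<close> with its angle
    \<open>\<eta>\<close>.\<close>
  have mono: "a * (1 + a) / ((tan x)\<^sup>2 - a) \<le> a * (1 + a) / ((tan y)\<^sup>2 - a) \<longleftrightarrow> y \<le> x"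
    if "0 < x" "x < pi / 2" "0 < y" "y < pi / 2" "a < (tan x)\<^sup>2" "a < (tan y)\<^sup>2" for x y
  proof -
    have "a * (1 + a) / ((tan x)\<^sup>2 - a) \<le> a * (1 + a) / ((tan y)\<^sup>2 - a) \<longleftrightarrow> (tan y)\<^sup>2 \<le> (tan x)\<^sup>2"
      using inv_le[of "a * (1 + a)" "(tan x)\<^sup>2 - a" "(tan y)\<^sup>2 - a"] that ab by simp
    also have "\<dots> \<longleftrightarrow> tan y \<le> tan x"
      using that tan_gt_zero[of x] tan_gt_zero[of y] by (simp add: power2_le_iff_abs_le)
    also have "\<dots> \<longleftrightarrow> y \<le> x"
      using that tan_mono_le_eq[of y x] by simp
    finally show ?thesis .
  qed
  have cos\<mu>: "(cos \<phi>)\<^sup>2 = mass_frac m P3 * mass_frac m P2"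
    unfolding \<mu> \<nu> using cos\<phi> by (simp add: mult.commute)
  have "capture_process m (capture_sequence n) \<longleftrightarrow>
      (\<exists>t. \<phi> \<le> t \<and> (2 * real n + 1) * t < pi \<and> sin ((2 * real n + 1) * t) = K * sin t)"
    by (rule capture_process_iff_angle[OF assms(1,4) \<phi> cos\<mu> K(1) K'[folded \<mu> \<nu>]])
  also have "\<dots> \<longleftrightarrow> (2 * real n + 1) * \<phi> < pi \<and> K * sin \<phi> \<le> sin ((2 * real n + 1) * \<phi>)"
    using n1 \<phi> K by (intro sin_multiple_root_iff) auto
  \<comment> \<open>The choice of \<open>K\<close> gives
    \<open>K sin \<phi> = sin (\<phi> + \<chi>)\<close> with \<open>\<phi> + \<chi>\<close> obtuse.
    The two resulting bounds on \<open>(2 n + 1) \<phi>\<close> are the conditions for the two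
    curves.\<close>
  also have "\<dots> \<longleftrightarrow> pi - (\<phi> + \<chi>) \<le> (2 * real n + 1) * \<phi> \<and> (2 * real n + 1) * \<phi> \<le> \<phi> + \<chi>"
    unfolding K(3)[symmetric] using \<phi> \<chi> n1 by (intro sin_ge_sin_obtuse_iff) auto
  also have "\<dots> \<longleftrightarrow> (2 * real n) * \<phi> \<le> \<chi> \<and> pi - \<chi> \<le> (2 * real n + 2) * \<phi>"
    by (auto simp: algebra_simps)
  also have "(2 * real n) * \<phi> \<le> \<chi> \<longleftrightarrow> (\<exists>b'. (a, b') \<in> C_even n \<and> b' \<le> b)"
  proof -
    have acute: "0 < \<eta> \<and> \<eta> < pi / 2" if "pi / (4 * real n + 2) < \<eta>" "\<eta> < pi / (4 * real n)" for \<eta>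
    proof -
      have "0 < pi / (4 * real n + 2)" "pi / (4 * real n) < pi / 2" using n1 by (auto simp: field_simps)
      then show ?thesis using that by linarith
    qed
    have gt: "a < (tan \<eta>)\<^sup>2" if "\<phi> \<le> \<eta>" "\<eta> < pi / 2" for \<eta>
    proof -
      have "tan \<phi> \<le> tan \<eta>" using that \<phi> by (intro tan_mono_le) auto
      then have "(tan \<phi>)\<^sup>2 \<le> (tan \<eta>)\<^sup>2" using tan_gt_zero[OF \<phi>] by (intro power_mono) auto
      then show ?thesis using t\<phi> by linarith
    qed
    have "(2 * real n) * \<phi> \<le> \<chi> \<longleftrightarrow> (\<exists>\<eta>. pi / (4 * real n + 2) < \<eta> \<and> \<eta> < pi / (4 * real n) \<and> \<phi> \<le> \<eta> \<and>
      a = tan \<eta> / tan (2 * real n * \<eta>))"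
      using lower_boundary[OF _ \<phi> \<chi> a, of "2 * real n"] n1 by simp
    also have "\<dots> \<longleftrightarrow> (\<exists>\<eta>. pi / (4 * real n + 2) < \<eta> \<and> \<eta> < pi / (4 * real n) \<and> a < (tan \<eta>)\<^sup>2 \<and>
      a = tan \<eta> / tan (2 * real n * \<eta>) \<and> a * (1 + a) / ((tan \<eta>)\<^sup>2 - a) \<le> b)"
    proof (rule ex_cong1)
      fix \<eta>
      show "(pi / (4 * real n + 2) < \<eta> \<and> \<eta> < pi / (4 * real n) \<and> \<phi> \<le> \<eta> \<and>
          a = tan \<eta> / tan (2 * real n * \<eta>)) \<longleftrightarrow>
        (pi / (4 * real n + 2) < \<eta> \<and> \<eta> < pi / (4 * real n) \<and> a < (tan \<eta>)\<^sup>2 \<and>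
          a = tan \<eta> / tan (2 * real n * \<eta>) \<and> a * (1 + a) / ((tan \<eta>)\<^sup>2 - a) \<le> b)"
        using acute[of \<eta>] gt[of \<eta>] mono[OF _ _ \<phi> _ t\<phi>, of \<eta>, folded b] by blast
    qed
    also have "\<dots> \<longleftrightarrow> (\<exists>b'. (a, b') \<in> C_even n \<and> b' \<le> b)"
      unfolding C_even_iff[OF assms(4)] by blast
    finally show ?thesis .
  qed
  also have "pi - \<chi> \<le> (2 * real n + 2) * \<phi> \<longleftrightarrow> (\<forall>b''. (a, b'') \<in> C_odd n \<longrightarrow> b \<le> b'')"
  proof -
    have acute: "0 < \<eta> \<and> \<eta> < pi / 2" if "pi / (4 * real n + 4) < \<eta>" "\<eta> < pi / (4 * real n + 2)" for \<eta>
    proof -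
      have "0 < pi / (4 * real n + 4)" "pi / (4 * real n + 2) < pi / 2" using n1 by (auto simp: field_simps)
      then show ?thesis using that by linarith
    qed
    \<comment> \<open>A parameter violating \<open>a < (tan \<eta>)^2\<close> already satisfies
      \<open>\<eta> \<le> \<phi>\<close>, so adding this guard to the premise below does not change
      the universal statement.\<close>
    have gt: "a < (tan \<eta>)\<^sup>2" if "\<not> \<eta> \<le> \<phi>" "\<eta> < pi / 2" for \<eta>
    proof -
      have "tan \<phi> \<le> tan \<eta>" using that \<phi> by (intro tan_mono_le) auto
      then have "(tan \<phi>)\<^sup>2 \<le> (tan \<eta>)\<^sup>2" using tan_gt_zero[OF \<phi>] by (intro power_mono) auto
      then show ?thesis using t\<phi> by linarith
    qed
    have "pi - \<chi> \<le> (2 * real n + 2) * \<phi> \<longleftrightarrow>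
      (\<forall>\<eta>. pi / (4 * real n + 4) < \<eta> \<and> \<eta> < pi / (4 * real n + 2) \<and>
        a = - tan \<eta> / tan ((2 * real n + 2) * \<eta>) \<longrightarrow> \<eta> \<le> \<phi>)"
      using upper_boundary[OF _ \<phi> \<chi> a, of "2 * real n + 2"] n1 by (simp add: algebra_simps)
    also have "\<dots> \<longleftrightarrow> (\<forall>\<eta>. pi / (4 * real n + 4) < \<eta> \<and> \<eta> < pi / (4 * real n + 2) \<and> a < (tan \<eta>)\<^sup>2 \<and>
      a = - tan \<eta> / tan ((2 * real n + 2) * \<eta>) \<longrightarrow> b \<le> a * (1 + a) / ((tan \<eta>)\<^sup>2 - a))"
    proof (rule all_cong1)
      fix \<eta>
      show "(pi / (4 * real n + 4) < \<eta> \<and> \<eta> < pi / (4 * real n + 2) \<and>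
          a = - tan \<eta> / tan ((2 * real n + 2) * \<eta>) \<longrightarrow> \<eta> \<le> \<phi>) \<longleftrightarrow>
        (pi / (4 * real n + 4) < \<eta> \<and> \<eta> < pi / (4 * real n + 2) \<and> a < (tan \<eta>)\<^sup>2 \<and>
          a = - tan \<eta> / tan ((2 * real n + 2) * \<eta>) \<longrightarrow> b \<le> a * (1 + a) / ((tan \<eta>)\<^sup>2 - a))"
        using acute[of \<eta>] gt[of \<eta>] mono[OF \<phi> _ _ t\<phi>, of \<eta>, folded b] by blast
    qed
    also have "\<dots> \<longleftrightarrow> (\<forall>b''. (a, b'') \<in> C_odd n \<longrightarrow> b \<le> b'')"
      unfolding C_odd_iff by blast
    finally show ?thesis .
  qed
  finally show ?thesis .
qed

end
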